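(* Let $G$ be a graph with $n$ vertices and $M=M[IAS(G)]$. Every graph falls under precisely one of the following five cases. \begin{enumerate} \item If $n\le 3$ and $G$ is connected, then $\kappa(M)=n$. \item If $G$ is disconnected, then $\kappa(M)=1$. \item If $n\ge 4$, $G$ is connected, and $G$ is not prime, then $\kappa(M)=3$. \item If $n\ge 5$, $G$ is prime, and $\kappa(M)<n$, then $\kappa(M)$ is odd and $\kappa(M)\ge 5$. \item If $n\ge 5$ and $\kappa(M)=n$, then $G$ is locally equivalent to (a graph isomorphic to) either the cycle graph $C_5$ or the wheel graph $W_5$. \end{enumerate}
   Context: A graph is a finite looped simple graph (loops allowed, no multiple edges). "Adjacent"/"neighbor" refer only to non-loop edges; $N_G(v)=\{w\neq v\mid vw\in E(G)\}$, $n=|V(G)|$. $A(G)$ is the $GF(2)$ adjacency matrix (diagonal entry $1$ iff the vertex is looped). $M[IAS(G)]$ is the binary matroid represented by $IAS(G)=(I\;A(G)\;A(G)+I)$, with ground set $W(G)$ of $3n$ elements $\phi_G(v),\chi_G(v),\psi_G(v)$. For a matroid $M$ on $W$ with rank $r$, $\lambda(S)=r(S)+r(W-S)-r(M)$; $S$ is a vertical $k$-separation if $\lambda(S)<k$ and $r(S),r(W-S)\ge k$; $\kappa(M)=\min(\{k\mid M\text{ has a vertical }k\text{-separation}\}\cup\{r(M)\})$. A split of $G$ is a partition $V(G)=V_1\cup V_2$ with $|V_1|,|V_2|\ge2$ and subsets $W_i\subseteq V_i$ such that every $v\in V_1$ has $N_G(v)\cap V_2=W_2$ if $v\in W_1$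 and $N_G(v)\cap V_2=\emptyset$ if $v\in V_1-W_1$; $G$ is prime if it has no split (so all graphs with at most 3 vertices are prime). Local equivalence: for $v\in V(G)$, the loop complement $G^v_\ell$ reverses the loop status of $v$; the simple local complement $G^v_s$ reverses all adjacencies between distinct elements of $N_G(v)$; the non-simple local complement $G^v_{ns}$ is obtained from $G^v_s$ by reversing loop status at every vertex of $N_G(v)$. Graphs are locally equivalent if one is obtained from the other by a sequence of these operations. $W_5$ is the wheel with 5 spokes (6 vertices). *)

theory Defs
  imports Complex_Main "HOL-Library.Z2" "HOL-Library.Function_Algebras"
begin

text \<open>Looped simple graphs: an edge is a set \<open>{u, v}\<close> of vertices; a loop at \<open>v\<close> is the
  edge \<open>{v, v} = {v}\<close>.\<close>

record 'a graph =
  verts :: "'a set"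
  edges :: "'a set set"

definition looped_graph :: "'a graph \<Rightarrow> bool" where
  "looped_graph G \<longleftrightarrow>
     finite (verts G) \<and> (\<forall>e\<in>edges G. \<exists>u\<in>verts G. \<exists>v\<in>verts G. e = {u, v})"

definition nbrs :: "'a graph \<Rightarrow> 'a \<Rightarrow> 'a set" where
  "nbrs G v = {w \<in> verts G. w \<noteq> v \<and> {v, w} \<in> edges G}"

text \<open>The graph without vertices counts as connected.\<close>

definition connected_graph :: "'a graph \<Rightarrow> bool" where
  "connected_graph G \<longleftrightarrow>
     (\<forall>u\<in>verts G. \<forall>v\<in>verts G. (u, v) \<in> {(x, y). x \<in> verts G \<and> y \<in> nbrs G x}\<^sup>*)"

definition graph_iso :: "'a graph \<Rightarrow> 'b graph \<Rightarrow> bool" where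
  "graph_iso G H \<longleftrightarrow>
     (\<exists>f. bij_betw f (verts G) (verts H) \<and>
          (\<forall>u\<in>verts G. \<forall>v\<in>verts G. {u, v} \<in> edges G \<longleftrightarrow> {f u, f v} \<in> edges H))"

definition is_split :: "'a graph \<Rightarrow> 'a set \<Rightarrow> 'a set \<Rightarrow> 'a set \<Rightarrow> 'a set \<Rightarrow> bool" where
  "is_split G V1 V2 W1 W2 \<longleftrightarrow>
     V1 \<union> V2 = verts G \<and> V1 \<inter> V2 = {} \<and> 2 \<le> card V1 \<and> 2 \<le> card V2 \<and>
     W1 \<subseteq> V1 \<and> W2 \<subseteq> V2 \<and>
     (\<forall>v\<in>W1. nbrs G v \<inter> V2 = W2) \<and> (\<forall>v\<in>V1 - W1. nbrs G v \<inter> V2 = {})"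

definition prime_graph :: "'a graph \<Rightarrow> bool" where
  "prime_graph G \<longleftrightarrow> (\<nexists>V1 V2 W1 W2. is_split G V1 V2 W1 W2)"

definition toggle_edges :: "'a set set \<Rightarrow> 'a graph \<Rightarrow> 'a graph" where
  "toggle_edges F G = G\<lparr>edges := (edges G - F) \<union> (F - edges G)\<rparr>"

definition loop_complement :: "'a graph \<Rightarrow> 'a \<Rightarrow> 'a graph" where
  "loop_complement G v = toggle_edges {{v}} G"

definition simple_local_complement :: "'a graph \<Rightarrow> 'a \<Rightarrow> 'a graph" where
  "simple_local_complement G v =
     toggle_edges {{x, y} | x y. x \<in> nbrs G v \<and> y \<in> nbrs G v \<and> x \<noteq> y} G"

definition nonsimple_local_complement :: "'a graph \<Rightarrow> 'a \<Rightarrow> 'a graph" where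
  "nonsimple_local_complement G v =
     toggle_edges {{x} | x. x \<in> nbrs G v} (simple_local_complement G v)"

definition local_step :: "'a graph \<Rightarrow> 'a graph \<Rightarrow> bool" where
  "local_step G H \<longleftrightarrow>
     (\<exists>v\<in>verts G. H = loop_complement G v \<or> H = simple_local_complement G v \<or>
        H = nonsimple_local_complement G v)"

definition locally_equivalent :: "'a graph \<Rightarrow> 'a graph \<Rightarrow> bool" where
  "locally_equivalent = local_step\<^sup>*\<^sup>*"

definition cycle5 :: "nat graph" where
  "cycle5 = \<lparr>verts = {0..<5}, edges = {{i, (i + 1) mod 5} | i. i < 5}\<rparr>"

definition wheel5 :: "nat graph" where
  "wheel5 = \<lparr>verts = {0..<6},
     edges = {{i, (i + 1) mod 5} | i. i < 5} \<union> {{i, 5} | i. i < 5}\<rparr>"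


record 'e matroid =
  ground :: "'e set"
  indep :: "'e set \<Rightarrow> bool"

definition rank_of :: "'e matroid \<Rightarrow> 'e set \<Rightarrow> nat" where
  "rank_of M S = Max (card ` {I. I \<subseteq> S \<and> indep M I})"

definition connectivity :: "'e matroid \<Rightarrow> 'e set \<Rightarrow> int" where
  "connectivity M S =
     int (rank_of M S) + int (rank_of M (ground M - S)) - int (rank_of M (ground M))"

definition vertical_separation :: "'e matroid \<Rightarrow> nat \<Rightarrow> 'e set \<Rightarrow> bool" where
  "vertical_separation M k S \<longleftrightarrow>
     S \<subseteq> ground M \<and> connectivity M S < int k \<and>
     k \<le> rank_of M S \<and> k \<le> rank_of M (ground M - S)"

text \<open>On a nonempty set of natural numbers, \<open>Inf\<close> is the minimum.\<close>

definition vertical_connectivity :: "'e matroid \<Rightarrow> nat" where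
  "vertical_connectivity M =
     Inf ({k. \<exists>S. vertical_separation M k S} \<union> {rank_of M (ground M)})"


global_interpretation gf2: vector_space "\<lambda>(c::bit) (x::'r \<Rightarrow> bit) r. c * x r"
  by unfold_locales (auto simp: fun_eq_iff algebra_simps)

text \<open>The matroid on the column labels \<open>E\<close> of a matrix over \<open>GF(2)\<close> with row labels \<open>R\<close>.
  Columns form an indexed family: distinct labels with equal columns are dependent (parallel),
  hence the injectivity condition.\<close>

definition matrix_column :: "'r set \<Rightarrow> ('r \<Rightarrow> 'e \<Rightarrow> bit) \<Rightarrow> 'e \<Rightarrow> 'r \<Rightarrow> bit" where
  "matrix_column R A e = (\<lambda>r. if r \<in> R then A r e else 0)"

definition binary_matroid :: "'r set \<Rightarrow> 'e set \<Rightarrow> ('r \<Rightarrow> 'e \<Rightarrow> bit) \<Rightarrow> 'e matroid" where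
  "binary_matroid R E A = \<lparr>ground = E,
     indep = (\<lambda>S. S \<subseteq> E \<and> inj_on (matrix_column R A) S \<and>
                  gf2.independent (matrix_column R A ` S))\<rparr>"

definition adjacency :: "'a graph \<Rightarrow> 'a \<Rightarrow> 'a \<Rightarrow> bit" where
  "adjacency G u v = of_bool ({u, v} \<in> edges G)"

datatype 'a isotropic = Phi 'a | Chi 'a | Psi 'a

fun IAS :: "'a graph \<Rightarrow> 'a \<Rightarrow> 'a isotropic \<Rightarrow> bit" where
  "IAS G u (Phi v) = of_bool (u = v)"
| "IAS G u (Chi v) = adjacency G u v"
| "IAS G u (Psi v) = adjacency G u v + of_bool (u = v)"

definition isotropic_ground :: "'a graph \<Rightarrow> 'a isotropic set" where
  "isotropic_ground G = Phi ` verts G \<union> Chi ` verts G \<union> Psi ` verts G"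

definition isotropic_matroid :: "'a graph \<Rightarrow> 'a isotropic matroid" where
  "isotropic_matroid G = binary_matroid (verts G) (isotropic_ground G) (IAS G)"

end

theory Submission
  imports Defs
begin

text \<open>
  Attach to a set \<open>Y\<close> of vertices its support, i.e. \<open>Y\<close> together with the vertices having an odd
  number of neighbours in \<open>Y\<close>. The sets supported in \<open>X\<close> form a \<open>GF(2)\<close>-space of dimension
  \<open>\<nu>(X) = |X| - c(X)\<close>, \<open>c\<close> being the cut-rank, and the \<open>3|X|\<close> elements of the matroid belonging
  to \<open>X\<close> have rank \<open>2|X| - \<nu>(X)\<close>. As the three elements of a vertex sum to zero, an optimal vertical
  separation may be taken to be a union of such triples, so \<open>\<kappa>\<close> is the minimum of \<open>n\<close> and the
  numbers \<open>2 c(X) + 1\<close> with \<open>c(X) < |X|, |V - X|\<close>. The values \<open>c(X) = 0\<close> and \<open>c(X) = 1\<close> correspond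
  to disconnectedness and to splits.

  Finally \<open>\<kappa> = n\<close> means that every nonempty set has a support of more than \<open>n/2\<close> vertices: the sets
  form a self-dual additive code that is extremal for its length. Its words supported in a given set
  can be counted, and the parity of the weight is additive; comparing the two excludes \<open>n = 4\<close> and
  odd \<open>n \<ge> 7\<close>, and deleting a vertex excludes even \<open>n \<ge> 8\<close>. On five vertices local complementations
  lead to \<open>C\<^sub>5\<close>; on six, they turn \<open>G - v\<close> into \<open>C\<^sub>5\<close>, and the minimum degree three makes \<open>v\<close>
  the hub of a wheel.
\<close>

\<comment> \<open>This rule would rewrite the scalar multiplication inside \<open>gf2.span\<close> and \<open>gf2.independent\<close>.\<close>
declare mult_bit_eq_and [simp del]

section \<open>Rank in a binary matroid\<close>

text \<open>Each further independent vector \<open>b\<close> doubles the span, which becomes the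
  disjoint union of the old span and its translate by \<open>b\<close>. Ranks can then be compared
  by counting.\<close>

lemma gf2_finite_card_span:
  fixes B :: "('r \<Rightarrow> bit) set"
  assumes "finite B" "gf2.independent B"
  shows "finite (gf2.span B) \<and> card (gf2.span B) = 2 ^ card B"
  using assms
proof (induction B rule: finite_induct)
  case empty
  then show ?case by simp
next
  case (insert b B)
  have ind: "b \<notin> gf2.span B" "gf2.independent B"
    using insert by (auto simp: gf2.independent_insert)
  have IH: "finite (gf2.span B)" "card (gf2.span B) = 2 ^ card B"
    using insert.IH ind(2) by auto
  \<comment> \<open>The only scalars are 0 and 1, so the existential in
    \<open>gf2.span_breakdown_eq\<close> becomes a disjunction.\<close>
  have two: "(\<exists>k::bit. P k) \<longleftrightarrow> P 0 \<or> P 1" for P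
    by (metis bit_not_zero_iff)
  have x: "x - (\<lambda>r. 0 * b r) = x" "x - (\<lambda>r. 1 * b r) = b + x" "b + (b + x) = x" for x
    by (auto simp: fun_eq_iff simp del: add_bit_eq_xor)
  have mem: "x \<in> gf2.span (insert b B) \<longleftrightarrow> x \<in> gf2.span B \<or> b + x \<in> gf2.span B" for x
    unfolding gf2.span_breakdown_eq two x(1,2) ..
  have eq: "gf2.span (insert b B) = gf2.span B \<union> (\<lambda>x. b + x) ` gf2.span B"
  proof (rule set_eqI)
    fix x
    have "x \<in> (\<lambda>x. b + x) ` gf2.span B \<longleftrightarrow> b + x \<in> gf2.span B"
      using x(3) imageI[of "b + x" "gf2.span B" "\<lambda>x. b + x"] by auto
    then show "x \<in> gf2.span (insert b B) \<longleftrightarrow> x \<in> gf2.span B \<union> (\<lambda>x. b + x) ` gf2.span B"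
      unfolding mem Un_iff by (rule arg_cong[OF sym])
  qed
  have disj: "gf2.span B \<inter> (\<lambda>x. b + x) ` gf2.span B = {}"
  proof (rule ccontr)
    assume "\<not> ?thesis"
    then obtain x where "x \<in> gf2.span B" "b + x \<in> gf2.span B" by blast
    then have "(b + x) - x \<in> gf2.span B" by (rule gf2.span_diff[rotated])
    then show False using ind by simp
  qed
  have "card ((\<lambda>x. b + x) ` gf2.span B) = card (gf2.span B)"
    by (rule card_image) (auto simp: inj_on_def)
  then show ?case
    unfolding eq using IH disj insert.hyps by (simp add: card_Un_disjoint)
qed

text \<open>An independent set of labels of maximal size already spans all columns of
  \<open>S\<close>; otherwise a label with a column outside its span could be added.\<close>

lemma two_power_rank_of:
  fixes A :: "'r \<Rightarrow> 'e \<Rightarrow> bit"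
  assumes "finite E" "S \<subseteq> E"
  shows "2 ^ rank_of (binary_matroid R E A) S = card (gf2.span (matrix_column R A ` S))"
    and "finite (gf2.span (matrix_column R A ` S))"
proof -
  let ?M = "binary_matroid R E A" and ?c = "matrix_column R A"
  let ?F = "{I. I \<subseteq> S \<and> indep ?M I}"
  have fS: "finite S" using assms finite_subset by blast
  have fin: "finite ?F" by (rule finite_subset[of _ "Pow S"]) (use fS in auto)
  have "{} \<in> ?F" by (simp add: binary_matroid_def gf2.independent_empty)
  then have "rank_of ?M S \<in> card ` ?F"
    unfolding rank_of_def using fin by (intro Max_in) auto
  then obtain I where I: "I \<subseteq> S" "indep ?M I" and r: "rank_of ?M S = card I" by auto
  have ind: "inj_on ?c I" "gf2.independent (?c ` I)"
    using I(2) by (auto simp: binary_matroid_def)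
  have "?c ` S \<subseteq> gf2.span (?c ` I)"
  proof (rule ccontr)
    assume "\<not> ?thesis"
    then obtain s where s: "s \<in> S" "?c s \<notin> gf2.span (?c ` I)" by auto
    \<comment> \<open>A column outside the span equals none of the chosen columns, so adding
      \<open>s\<close> also preserves injectivity on labels.\<close>
    then have n: "?c s \<notin> ?c ` I" using gf2.span_superset by blast
    then have "insert s I \<in> ?F"
      using s I ind assms by (auto simp: binary_matroid_def gf2.independent_insertI)
    then have "card (insert s I) \<le> rank_of ?M S"
      unfolding rank_of_def using fin by (intro Max_ge) auto
    moreover have "s \<notin> I" using n by blast
    ultimately show False
      using r finite_subset[OF I(1) fS] by simp
  qed
  moreover have "?c ` I \<subseteq> gf2.span (?c ` S)"
    using I(1) gf2.span_superset by blast
  ultimately have eq: "gf2.span (?c ` S) = gf2.span (?c ` I)"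
    by (simp add: gf2.span_eq)
  show "2 ^ rank_of ?M S = card (gf2.span (?c ` S))" "finite (gf2.span (?c ` S))"
    unfolding eq r using gf2_finite_card_span[OF _ ind(2)] finite_subset[OF I(1) fS] ind(1)
    by (auto simp: card_image)
qed

section \<open>Stabilizer words\<close>

text \<open>The product over GF(2) of the adjacency matrix, diagonal removed, with the indicator
  vector of \<open>Y\<close>. Loops may be ignored: the span of a union of triples contains the unit
  vectors of its vertices.\<close>

definition odd_nbrs :: "'a graph \<Rightarrow> 'a set \<Rightarrow> 'a set" where
  "odd_nbrs G Y = {v \<in> verts G. odd (card (nbrs G v \<inter> Y))}"

definition supp :: "'a graph \<Rightarrow> 'a set \<Rightarrow> 'a set" where
  "supp G Y = Y \<union> odd_nbrs G Y"

definition words :: "'a graph \<Rightarrow> 'a set \<Rightarrow> 'a set set" where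
  "words G X = {Y. Y \<subseteq> verts G \<and> supp G Y \<subseteq> X}"

lemma odd_card_sym_diff:
  assumes "finite A" "finite B"
  shows "odd (card (sym_diff A B)) \<longleftrightarrow> odd (card A) \<noteq> odd (card B)"
proof -
  have "card A = card (A - B) + card (A \<inter> B)" "card B = card (B - A) + card (A \<inter> B)"
    using assms by (metis Diff_Int2 Un_Diff_Int card_Un_disjoint finite_Diff finite_Int
      Int_commute Diff_disjoint inf_commute Int_Diff_disjoint)+
  moreover have "card (sym_diff A B) = card (A - B) + card (B - A)"
    using assms by (intro card_Un_disjoint) auto
  ultimately show ?thesis by auto
qed

lemma nbrs_subset: "nbrs G v \<subseteq> verts G"
  by (auto simp: nbrs_def)

lemma nbrs_irrefl [simp]: "v \<notin> nbrs G v"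
  by (auto simp: nbrs_def)

lemma nbrs_sym: "v \<in> verts G \<Longrightarrow> w \<in> nbrs G v \<Longrightarrow> v \<in> nbrs G w"
  by (auto simp: nbrs_def insert_commute)

lemma nbrs_sym_iff: "v \<in> verts G \<Longrightarrow> w \<in> verts G \<Longrightarrow> w \<in> nbrs G v \<longleftrightarrow> v \<in> nbrs G w"
  by (auto simp: nbrs_def insert_commute)

lemma finite_verts: "looped_graph G \<Longrightarrow> finite (verts G)"
  by (simp add: looped_graph_def)

lemma finite_nbrs: "looped_graph G \<Longrightarrow> finite (nbrs G v)"
  using finite_verts nbrs_subset finite_subset by metis

text \<open>Linearity over GF(2), with symmetric difference as addition; it makes
  \<open>words G X\<close> a vector space.\<close>

lemma odd_nbrs_sym_diff:
  assumes "looped_graph G"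
  shows "odd_nbrs G (sym_diff Y Z) = sym_diff (odd_nbrs G Y) (odd_nbrs G Z)"
proof -
  have "odd (card (nbrs G v \<inter> sym_diff Y Z)) \<longleftrightarrow>
      odd (card (nbrs G v \<inter> Y)) \<noteq> odd (card (nbrs G v \<inter> Z))" for v
  proof -
    have "nbrs G v \<inter> sym_diff Y Z = sym_diff (nbrs G v \<inter> Y) (nbrs G v \<inter> Z)" by auto
    then show ?thesis
      using odd_card_sym_diff[of "nbrs G v \<inter> Y" "nbrs G v \<inter> Z"] finite_nbrs[OF assms] by simp
  qed
  then show ?thesis by (auto simp: odd_nbrs_def)
qed

lemma odd_nbrs_empty [simp]: "odd_nbrs G {} = {}"
  by (simp add: odd_nbrs_def)

lemma odd_nbrs_subset: "odd_nbrs G Y \<subseteq> verts G"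
  by (auto simp: odd_nbrs_def)

lemma odd_nbrs_single: "y \<in> verts G \<Longrightarrow> odd_nbrs G {y} = nbrs G y"
  using nbrs_sym_iff[of y G] nbrs_subset[of G y]
  by (force simp: odd_nbrs_def Int_insert_right)

lemma words_iff:
  "X \<subseteq> verts G \<Longrightarrow> Y \<in> words G X \<longleftrightarrow> Y \<subseteq> X \<and> odd_nbrs G Y \<subseteq> X"
  by (auto simp: words_def supp_def)

lemma words_sym_diff:
  assumes "looped_graph G" "Y \<in> words G X" "Z \<in> words G X"
  shows "sym_diff Y Z \<in> words G X"
  using assms(2,3) by (auto simp: words_def supp_def odd_nbrs_sym_diff[OF assms(1)])

lemma empty_in_words: "{} \<in> words G X"
  by (simp add: words_def supp_def)

lemma finite_words: "looped_graph G \<Longrightarrow> finite (words G X)"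
  by (rule finite_subset[of _ "Pow (verts G)"]) (auto simp: words_def finite_verts)

lemma finite_supp: "looped_graph G \<Longrightarrow> Y \<subseteq> verts G \<Longrightarrow> finite (supp G Y)"
  using finite_subset[OF _ finite_verts] odd_nbrs_subset by (metis supp_def Un_subset_iff)

lemma sym_diff_cancel: "sym_diff Y (sym_diff Y Z) = Z"
  by auto

text \<open>Both sides count the adjacent pairs between \<open>Y\<close> and
  \<open>Z\<close>.\<close>

lemma sum_card_nbrs:
  assumes "looped_graph G" "Y \<subseteq> verts G" "Z \<subseteq> verts G"
  shows "(\<Sum>z\<in>Z. card (nbrs G z \<inter> Y)) = (\<Sum>y\<in>Y. card (nbrs G y \<inter> Z))"
proof -
  have fin: "finite Y" "finite Z" using assms finite_subset[OF _ finite_verts] by auto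
  have c: "card (nbrs G v \<inter> S) = (\<Sum>s\<in>S. if s \<in> nbrs G v then 1 else 0)" if "finite S" for v S
    using that by (simp add: sum.If_cases Int_commute)
  have "(\<Sum>z\<in>Z. card (nbrs G z \<inter> Y)) = (\<Sum>z\<in>Z. \<Sum>y\<in>Y. if y \<in> nbrs G z then 1 else 0)"
    using c[OF fin(1)] by simp
  also have "\<dots> = (\<Sum>y\<in>Y. \<Sum>z\<in>Z. if y \<in> nbrs G z then 1 else 0)" by (rule sum.swap)
  also have "\<dots> = (\<Sum>y\<in>Y. \<Sum>z\<in>Z. if z \<in> nbrs G y then 1 else 0)"
  proof (intro sum.cong refl)
    fix y z assume "y \<in> Y" "z \<in> Z"
    then have "y \<in> nbrs G z \<longleftrightarrow> z \<in> nbrs G y" using nbrs_sym_iff assms by (metis subsetD)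
    then show "(if y \<in> nbrs G z then 1 else 0) = (if z \<in> nbrs G y then 1 else (0::nat))" by simp
  qed
  also have "\<dots> = (\<Sum>y\<in>Y. card (nbrs G y \<inter> Z))"
    using c[OF fin(2)] by simp
  finally show ?thesis .
qed

text \<open>Row rank equals column rank for the biadjacency matrix of \<open>X\<close> and its complement: both
  sides evaluate the character sum of \<open>(-1) ^ e(Y, Z)\<close> over \<open>Y \<subseteq> X\<close> and \<open>Z \<subseteq> V - X\<close>.\<close>

lemma card_words_dual:
  assumes G: "looped_graph G" and X: "X \<subseteq> verts G"
  shows "card (words G X) * 2 ^ card (verts G - X) = card (words G (verts G - X)) * 2 ^ card X"
proof -
  let ?s = "\<lambda>Y Z. (-1::int) ^ (\<Sum>z\<in>Z. card (nbrs G z \<inter> Y))"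
  have key: "(\<Sum>Y\<in>Pow X. \<Sum>Z\<in>Pow (verts G - X). ?s Y Z) =
      int (card (words G X)) * 2 ^ card (verts G - X)"
    if X: "X \<subseteq> verts G" for X
  proof -
    let ?X' = "verts G - X"
    have fin: "finite ?X'" "finite X" using finite_verts[OF G] finite_subset X by auto
    have inner: "(\<Sum>Z\<in>Pow ?X'. ?s Y Z) = (if Y \<in> words G X then 2 ^ card ?X' else 0)"
      if Y: "Y \<subseteq> X" for Y
    proof -
      \<comment> \<open>The exponent is additive in \<open>Z\<close>, so the sum over subsets
        factorizes. The factor at \<open>z\<close> is 2 or 0, according to whether \<open>z\<close>
        has an even or odd number of neighbours in \<open>Y\<close>.\<close>
      have "(\<Sum>Z\<in>Pow ?X'. ?s Y Z) = (\<Prod>z\<in>?X'. (-1) ^ card (nbrs G z \<inter> Y) + 1)"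
        by (simp add: prod_add[OF fin(1)] power_sum)
      also have "\<dots> = (if Y \<in> words G X then 2 ^ card ?X' else 0)"
      proof (cases "Y \<in> words G X")
        case True
        then have "even (card (nbrs G z \<inter> Y))" if "z \<in> ?X'" for z
          using that X by (auto simp: words_iff odd_nbrs_def)
        then show ?thesis using True by simp
      next
        case False
        then obtain z where "z \<in> ?X'" "odd (card (nbrs G z \<inter> Y))"
          using Y X by (auto simp: words_iff odd_nbrs_def)
        then show ?thesis using False fin by (auto intro!: prod_zero bexI[of _ z])
      qed
      finally show ?thesis .
    qed
    have "(\<Sum>Y\<in>Pow X. \<Sum>Z\<in>Pow ?X'. ?s Y Z) =
        (\<Sum>Y\<in>Pow X. if Y \<in> words G X then 2 ^ card ?X' else 0)"
      by (intro sum.cong refl inner) auto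
    also have "\<dots> = (\<Sum>Y\<in>words G X. 2 ^ card ?X')"
      using fin X by (intro sum.mono_neutral_cong_right) (auto simp: words_iff)
    finally show ?thesis by simp
  qed
  have dbl: "verts G - (verts G - X) = X" using X by auto
  have "(\<Sum>Y\<in>Pow X. \<Sum>Z\<in>Pow (verts G - X). ?s Y Z) =
      (\<Sum>Y\<in>Pow X. \<Sum>Z\<in>Pow (verts G - X). ?s Z Y)"
  proof (intro sum.cong refl)
    fix Y Z assume "Y \<in> Pow X" "Z \<in> Pow (verts G - X)"
    then have "Y \<subseteq> verts G" "Z \<subseteq> verts G" using X by auto
    then show "?s Y Z = ?s Z Y" using sum_card_nbrs[OF G] by metis
  qed
  also have "\<dots> = (\<Sum>Z\<in>Pow (verts G - X). \<Sum>Y\<in>Pow X. ?s Z Y)" by (rule sum.swap)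
  finally have "int (card (words G X)) * 2 ^ card (verts G - X) =
      int (card (words G (verts G - X))) * 2 ^ card X"
    unfolding key[OF X] using key[of "verts G - X"] unfolding dbl by simp
  then have "int (card (words G X) * 2 ^ card (verts G - X)) =
      int (card (words G (verts G - X)) * 2 ^ card X)" by simp
  then show ?thesis unfolding of_nat_eq_iff .
qed

text \<open>Rank-nullity for the linear map \<open>Q\<close> to \<open>odd_nbrs G Q - X\<close> on
  subsets of \<open>X\<close>: its kernel is \<open>words G X\<close>, and \<open>h\<close> combines
  a chosen preimage of an image point with a kernel element.\<close>

lemma card_cosets_words:
  assumes G: "looped_graph G" and X: "X \<subseteq> verts G"
  shows "card ((\<lambda>Q. odd_nbrs G Q - X) ` Pow X) * card (words G X) = 2 ^ card X"
proof -
  define g where "g Q = odd_nbrs G Q - X" for Q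
  define q where "q = inv_into (Pow X) g"
  define h where "h = (\<lambda>(S, Y). sym_diff (q S) Y)"
  define h' where "h' Q = (g Q, sym_diff (q (g Q)) Q)" for Q
  have q: "q S \<subseteq> X" "g (q S) = S" if "S \<in> g ` Pow X" for S
    using inv_into_into[OF that] f_inv_into_f[OF that] by (auto simp: q_def)
  have W: "Y \<in> words G X \<longleftrightarrow> Y \<subseteq> X \<and> g Y = {}" for Y
    using X by (auto simp: words_iff g_def)
  have g: "g (sym_diff Y Z) = sym_diff (g Y) (g Z)" for Y Z
    unfolding g_def odd_nbrs_sym_diff[OF G, of Y Z] by blast
  have "bij_betw h (g ` Pow X \<times> words G X) (Pow X)"
  proof (rule bij_betw_byWitness[where f' = h'])
    show "\<forall>a\<in>g ` Pow X \<times> words G X. h' (h a) = a"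
    proof
      fix a assume "a \<in> g ` Pow X \<times> words G X"
      then obtain S Y where a: "a = (S, Y)" and S: "S \<in> g ` Pow X" and Y: "Y \<in> words G X"
        by (rule SigmaE)
      have h: "h a = sym_diff (q S) Y" by (simp add: h_def a)
      have "g (h a) = S"
        unfolding h g q(2)[OF S] using Y W by auto
      then show "h' (h a) = a"
        unfolding h'_def by (simp add: h) (auto simp: a)
    qed
    show "\<forall>Q\<in>Pow X. h (h' Q) = Q"
      by (auto simp: h_def h'_def)
    show "h ` (g ` Pow X \<times> words G X) \<subseteq> Pow X"
      using q(1) W by (auto simp: h_def dest: subsetD)
    show "h' ` Pow X \<subseteq> g ` Pow X \<times> words G X"
    proof (rule image_subsetI)
      fix Q assume Q: "Q \<in> Pow X"
      have S: "g Q \<in> g ` Pow X" using Q by (rule imageI)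
      have "g (sym_diff (q (g Q)) Q) = {}"
        unfolding g q(2)[OF S] by simp
      then have "sym_diff (q (g Q)) Q \<in> words G X"
        using q(1)[OF S] Q W by auto
      then show "h' Q \<in> g ` Pow X \<times> words G X"
        using S by (simp add: h'_def)
    qed
  qed
  then have "card (g ` Pow X \<times> words G X) = card (Pow X)" by (rule bij_betw_same_card)
  then show ?thesis
    using finite_subset[OF X finite_verts[OF G]]
    by (simp add: card_cartesian_product card_Pow g_def[abs_def])
qed

section \<open>Rank of a union of vertex triples\<close>

definition ind :: "'a set \<Rightarrow> 'a \<Rightarrow> bit" where
  "ind S = (\<lambda>r. of_bool (r \<in> S))"

lemma ind_add: "ind S + ind T = ind (sym_diff S T)"
  by (auto simp: ind_def fun_eq_iff)

lemma ind_empty: "ind {} = 0"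
  by (auto simp: ind_def fun_eq_iff)

lemma inj_ind: "inj ind"
  by (auto simp: inj_on_def ind_def fun_eq_iff)

definition triples :: "'a set \<Rightarrow> 'a isotropic set" where
  "triples X = Phi ` X \<union> Chi ` X \<union> Psi ` X"

lemma isotropic_ground_triples: "isotropic_ground G = triples (verts G)"
  by (simp add: isotropic_ground_def triples_def)

lemma ground_isotropic_matroid [simp]: "ground (isotropic_matroid G) = isotropic_ground G"
  by (simp add: isotropic_matroid_def binary_matroid_def)

lemma triples_mono: "X \<subseteq> Y \<Longrightarrow> triples X \<subseteq> triples Y"
  by (auto simp: triples_def)

lemma triples_diff: "triples (X - Y) = triples X - triples Y"
  by (auto simp: triples_def)

lemma finite_isotropic_ground: "looped_graph G \<Longrightarrow> finite (isotropic_ground G)"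
  by (simp add: isotropic_ground_def finite_verts)

abbreviation col :: "'a graph \<Rightarrow> 'a isotropic \<Rightarrow> 'a \<Rightarrow> bit" where
  "col G \<equiv> matrix_column (verts G) (IAS G)"

lemma col_Phi: "v \<in> verts G \<Longrightarrow> col G (Phi v) = ind {v}"
  by (auto simp: matrix_column_def ind_def fun_eq_iff)

lemma col_Chi: "col G (Chi v) = ind {r \<in> verts G. {r, v} \<in> edges G}"
  by (auto simp: matrix_column_def ind_def fun_eq_iff adjacency_def)

lemma col_triple:
  "col G (Psi v) = col G (Phi v) + col G (Chi v)"
  "col G (Phi v) = col G (Psi v) + col G (Chi v)"
  "col G (Chi v) = col G (Phi v) + col G (Psi v)"
  by (auto simp: matrix_column_def fun_eq_iff adjacency_def)

text \<open>The \<open>Phi\<close> columns span everything inside \<open>X\<close>, so only the part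
  of a vector outside \<open>X\<close> is restricted. There a \<open>Chi\<close> or
  \<open>Psi\<close> column is a neighbourhood, and sums of neighbourhoods over \<open>Q\<close>
  give \<open>odd_nbrs G Q\<close>.\<close>

lemma span_triples:
  assumes G: "looped_graph G" and X: "X \<subseteq> verts G"
  shows "gf2.span (col G ` triples X) =
    ind ` {T. T \<subseteq> verts G \<and> T - X \<in> (\<lambda>Q. odd_nbrs G Q - X) ` Pow X}" (is "?L = ind ` ?R'")
proof -
  define R where "R = ?R'"
  have R_iff: "T \<in> R \<longleftrightarrow> T \<subseteq> verts G \<and> (\<exists>Q\<subseteq>X. T - X = odd_nbrs G Q - X)" for T
    by (auto simp: R_def)
  have Rsd: "sym_diff S T \<in> R" if S: "S \<in> R" and T: "T \<in> R" for S T
  proof -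
    obtain P Q where PQ: "P \<subseteq> X" "Q \<subseteq> X" "S - X = odd_nbrs G P - X" "T - X = odd_nbrs G Q - X"
      using S T unfolding R_iff by blast
    have "sym_diff S T - X = sym_diff (S - X) (T - X)" by blast
    also have "\<dots> = odd_nbrs G (sym_diff P Q) - X"
      unfolding PQ(3,4) odd_nbrs_sym_diff[OF G] by blast
    finally have "sym_diff S T - X = odd_nbrs G (sym_diff P Q) - X" .
    moreover have "sym_diff P Q \<subseteq> X" "sym_diff S T \<subseteq> verts G" using S T PQ(1,2) by (auto simp: R_iff)
    ultimately show ?thesis unfolding R_iff by blast
  qed
  have add: "x + y \<in> ind ` R" if xy: "x \<in> ind ` R" "y \<in> ind ` R" for x y
  proof -
    obtain S T where "x = ind S" "y = ind T" "S \<in> R" "T \<in> R" using xy by blast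
    then show ?thesis unfolding \<open>x = _\<close> \<open>y = _\<close> ind_add by (intro imageI Rsd)
  qed
  have "{} \<in> R" by (force simp: R_iff)
  then have zero: "0 \<in> ind ` R" using ind_empty by (metis imageI)
  have sub: "gf2.subspace (ind ` R)"
  proof (rule gf2.subspaceI)
    show "0 \<in> ind ` R" by (rule zero)
    show "x + y \<in> ind ` R" if "x \<in> ind ` R" "y \<in> ind ` R" for x y
      using that by (rule add)
    show "(\<lambda>r. c * x r) \<in> ind ` R" if "x \<in> ind ` R" for c x
      using that zero by (cases c) (simp_all add: zero_fun_def)
  qed
  have cols: "col G e \<in> ind ` R" if e: "e \<in> triples X" for e
  proof -
    have phi: "col G (Phi v) \<in> ind ` R" if "v \<in> X" for v
    proof -
      have "{v} - X = odd_nbrs G {} - X" using that by simp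
      then have "{v} \<in> R" unfolding R_iff using that X by blast
      moreover have "col G (Phi v) = ind {v}" using that X by (intro col_Phi) blast
      ultimately show ?thesis by simp
    qed
    have chi: "col G (Chi v) \<in> ind ` R" if "v \<in> X" for v
    proof -
      have "v \<in> verts G" using that X by blast
      then have "{r \<in> verts G. {r, v} \<in> edges G} - X = odd_nbrs G {v} - X"
        using that by (auto simp: odd_nbrs_single nbrs_def insert_commute)
      then have "{r \<in> verts G. {r, v} \<in> edges G} \<in> R" unfolding R_iff using that by blast
      then show ?thesis unfolding col_Chi by (rule imageI)
    qed
    have psi: "col G (Psi v) \<in> ind ` R" if "v \<in> X" for v
      unfolding col_triple(1) using phi[OF that] chi[OF that] by (rule add)
    from e consider v where "v \<in> X" "e = Phi v" | v where "v \<in> X" "e = Chi v"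
      | v where "v \<in> X" "e = Psi v" by (auto simp: triples_def)
    then show ?thesis by cases (simp_all add: phi chi psi)
  qed
  have 1: "?L \<subseteq> ind ` R"
    by (rule gf2.span_minimal[OF _ sub]) (use cols in blast)
  have fin: "finite X" using X finite_verts[OF G] finite_subset by blast
  have indX: "ind P \<in> ?L" if "P \<subseteq> X" for P
    using finite_subset[OF that fin] that
  proof (induction P rule: finite_induct)
    case empty
    show ?case unfolding ind_empty by (rule gf2.span_zero)
  next
    case (insert v P)
    have "ind {v} \<in> ?L"
      using insert.prems X col_Phi[of v G]
      by (intro gf2.span_base) (auto simp: triples_def image_iff intro!: bexI[of _ "Phi v"])
    moreover have "ind P \<in> ?L" using insert by simp
    ultimately have "ind {v} + ind P \<in> ?L" by (rule gf2.span_add)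
    moreover have "sym_diff {v} P = insert v P" using insert.hyps by auto
    ultimately show ?case by (simp add: ind_add)
  qed
  have indQ: "\<exists>T\<subseteq>verts G. ind T \<in> ?L \<and> T - X = odd_nbrs G Q - X" if "Q \<subseteq> X" for Q
    using finite_subset[OF that fin] that
  proof (induction Q rule: finite_induct)
    case empty
    have "ind {} \<in> ?L" unfolding ind_empty by (rule gf2.span_zero)
    then show ?case by auto
  next
    case (insert v Q)
    then obtain T where T: "T \<subseteq> verts G" "ind T \<in> ?L" "T - X = odd_nbrs G Q - X" by auto
    have v: "v \<in> X" "v \<in> verts G" using insert.prems X by auto
    let ?N = "{r \<in> verts G. {r, v} \<in> edges G}"
    have "?N - X = odd_nbrs G {v} - X"
      using v by (auto simp: odd_nbrs_single nbrs_def insert_commute)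
    have "ind ?N \<in> ?L"
      using v col_Chi[of G v]
      by (intro gf2.span_base) (auto simp: triples_def image_iff intro!: bexI[of _ "Chi v"])
    then have "ind (sym_diff ?N T) \<in> ?L"
      unfolding ind_add[symmetric] using T(2) by (rule gf2.span_add)
    moreover have "sym_diff ?N T - X = odd_nbrs G (insert v Q) - X"
    proof -
      have i: "insert v Q = sym_diff {v} Q" using insert.hyps by auto
      have "sym_diff ?N T - X = sym_diff (?N - X) (T - X)" by blast
      also have "\<dots> = odd_nbrs G (insert v Q) - X"
        unfolding \<open>?N - X = odd_nbrs G {v} - X\<close> T(3) i odd_nbrs_sym_diff[OF G] by blast
      finally show ?thesis .
    qed
    moreover have "sym_diff ?N T \<subseteq> verts G" using T(1) by blast
    ultimately show ?case by blast
  qed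
  have 2: "ind ` R \<subseteq> ?L"
  proof (rule image_subsetI)
    fix T assume T: "T \<in> R"
    then obtain Q where "Q \<subseteq> X" "T - X = odd_nbrs G Q - X" unfolding R_iff by blast
    then obtain U where U: "ind U \<in> ?L" "U - X = T - X" using indQ[of Q] by auto
    \<comment> \<open>\<open>T\<close> agrees outside \<open>X\<close> with the vector
      \<open>U\<close> already in the span, so their difference is a sum of unit vectors of
      \<open>X\<close>.\<close>
    have "ind (sym_diff U T) \<in> ?L" by (rule indX) (use U(2) in blast)
    with U(1) have "ind U + ind (sym_diff U T) \<in> ?L" by (rule gf2.span_add)
    then show "ind T \<in> ?L" by (simp only: ind_add sym_diff_cancel)
  qed
  show ?thesis using 1 2 unfolding R_def by (rule subset_antisym)
qed

text \<open>A vector of the span splits into an arbitrary part inside \<open>X\<close> and an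
  independent choice from the image outside \<open>X\<close>.\<close>

lemma card_span_triples:
  assumes G: "looped_graph G" and X: "X \<subseteq> verts G"
  shows "card (gf2.span (col G ` triples X)) =
    2 ^ card X * card ((\<lambda>Q. odd_nbrs G Q - X) ` Pow X)"
proof -
  define D where "D = (\<lambda>Q. odd_nbrs G Q - X) ` Pow X"
  have D: "S \<inter> X = {}" "S \<subseteq> verts G" if "S \<in> D" for S
    using that odd_nbrs_subset[of G] by (auto simp: D_def)
  have "card (gf2.span (col G ` triples X)) = card {T. T \<subseteq> verts G \<and> T - X \<in> D}"
    unfolding span_triples[OF assms] D_def by (rule card_image) (meson inj_ind inj_on_subset subset_UNIV)
  also have "bij_betw (\<lambda>T. (T \<inter> X, T - X)) {T. T \<subseteq> verts G \<and> T - X \<in> D} (Pow X \<times> D)"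
  proof (rule bij_betw_byWitness[where f' = "\<lambda>(P, S). P \<union> S"])
    show "(\<lambda>(P, S). P \<union> S) ` (Pow X \<times> D) \<subseteq> {T. T \<subseteq> verts G \<and> T - X \<in> D}"
    proof clarify
      fix P S assume P: "P \<subseteq> X" and S: "S \<in> D"
      have "P \<union> S - X = S" using P D(1)[OF S] by blast
      then show "P \<union> S \<subseteq> verts G \<and> P \<union> S - X \<in> D" using S P X D(2)[OF S] by auto
    qed
    show "\<forall>a\<in>Pow X \<times> D. (\<lambda>T. (T \<inter> X, T - X)) ((\<lambda>(P, S). P \<union> S) a) = a"
      using D(1) by auto
  qed auto
  then have "card {T. T \<subseteq> verts G \<and> T - X \<in> D} = card (Pow X \<times> D)" by (rule bij_betw_same_card)
  also have "\<dots> = 2 ^ card X * card D"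
    using finite_subset[OF X finite_verts[OF G]] by (simp add: card_cartesian_product card_Pow)
  finally show ?thesis by (simp add: D_def)
qed

text \<open>The dimension of \<open>words G X\<close>, as \<open>card_words\<close> shows;
  \<open>rank_of_triples\<close> shows that the subtraction does not truncate.\<close>

definition nullity :: "'a graph \<Rightarrow> 'a set \<Rightarrow> nat" where
  "nullity G X = 2 * card X - rank_of (isotropic_matroid G) (triples X)"

lemma two_power_rank_of_isotropic:
  assumes "looped_graph G" "S \<subseteq> isotropic_ground G"
  shows "2 ^ rank_of (isotropic_matroid G) S = card (gf2.span (col G ` S))"
    and "finite (gf2.span (col G ` S))"
  unfolding isotropic_matroid_def
  using two_power_rank_of[OF finite_isotropic_ground[OF assms(1)] assms(2)] by auto

text \<open>With \<open>c\<close> the size of the image outside \<open>X\<close>, the span has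
  \<open>2 ^ card X * c\<close> elements while \<open>c\<close> times the number of words is
  \<open>2 ^ card X\<close>. So \<open>c\<close> is a power of two, and its exponent, the cut-rank,
  links rank and nullity.\<close>

lemma nullity_properties:
  assumes G: "looped_graph G" and X: "X \<subseteq> verts G"
  shows rank_of_triples: "rank_of (isotropic_matroid G) (triples X) + nullity G X = 2 * card X"
    and card_words: "card (words G X) = 2 ^ nullity G X"
    and nullity_le: "nullity G X \<le> card X"
proof -
  let ?r = "rank_of (isotropic_matroid G) (triples X)"
  define c where "c = card ((\<lambda>Q. odd_nbrs G Q - X) ` Pow X)"
  define k where "k = card (words G X)"
  have "triples X \<subseteq> isotropic_ground G"
    unfolding isotropic_ground_triples using X by (rule triples_mono)
  then have r: "2 ^ ?r = 2 ^ card X * c"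
    using two_power_rank_of_isotropic[OF G] card_span_triples[OF assms] by (simp add: c_def)
  have ck: "c * k = 2 ^ card X"
    using card_cosets_words[OF assms] by (simp add: c_def k_def)
  have pos: "c > 0" "k > 0" using ck by (cases c; cases k; simp)+
  have "(2::nat) ^ card X \<le> 2 ^ ?r" unfolding r using pos by simp
  then have le1: "card X \<le> ?r" by simp
  then have "(2::nat) ^ ?r = 2 ^ card X * 2 ^ (?r - card X)" by (simp flip: power_add)
  then have c: "c = 2 ^ (?r - card X)" unfolding r by simp
  have "c \<le> 2 ^ card X" unfolding ck[symmetric] using pos by simp
  then have le2: "?r - card X \<le> card X" unfolding c by simp
  then have "(2::nat) ^ card X = 2 ^ (?r - card X) * 2 ^ nullity G X"
    unfolding nullity_def power_add[symmetric] using le1 by simp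
  with ck show "card (words G X) = 2 ^ nullity G X" unfolding c k_def[symmetric] by simp
  show "?r + nullity G X = 2 * card X" "nullity G X \<le> card X"
    using le1 le2 by (auto simp: nullity_def)
qed

text \<open>Symmetry of the cut-rank \<open>card X - nullity G X\<close> under complementation,
  written without subtraction.\<close>

lemma nullity_dual:
  assumes G: "looped_graph G" and X: "X \<subseteq> verts G"
  shows "nullity G X + card (verts G - X) = nullity G (verts G - X) + card X"
proof -
  have "(2::nat) ^ (nullity G X + card (verts G - X)) = 2 ^ (nullity G (verts G - X) + card X)"
    using card_words_dual[OF assms] card_words[OF assms] card_words[OF G, of "verts G - X"]
    by (simp add: power_add)
  then show ?thesis by simp
qed

lemma card_verts_split:
  assumes "looped_graph G" "X \<subseteq> verts G"
  shows "card X + card (verts G - X) = card (verts G)"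
  using assms finite_verts[OF assms(1)] finite_subset[OF assms(2)]
  by (metis card_Diff_subset card_mono le_add_diff_inverse)

lemma rank_of_isotropic_ground:
  assumes G: "looped_graph G"
  shows "rank_of (isotropic_matroid G) (isotropic_ground G) = card (verts G)"
proof -
  have "words G (verts G) = Pow (verts G)"
    using odd_nbrs_subset[of G] by (auto simp: words_def supp_def)
  then have "(2::nat) ^ nullity G (verts G) = 2 ^ card (verts G)"
    using card_words[OF G subset_refl] finite_verts[OF G] by (simp add: card_Pow)
  then show ?thesis
    using rank_of_triples[OF G subset_refl] by (simp add: isotropic_ground_triples)
qed

lemma rank_of_mono_span:
  assumes G: "looped_graph G" and S: "S \<subseteq> isotropic_ground G" and T: "T \<subseteq> isotropic_ground G"
    and sub: "col G ` S \<subseteq> gf2.span (col G ` T)"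
  shows "rank_of (isotropic_matroid G) S \<le> rank_of (isotropic_matroid G) T"
proof -
  have "gf2.span (col G ` S) \<subseteq> gf2.span (col G ` T)"
    using sub by (rule gf2.span_minimal) (rule gf2.subspace_span)
  then have "(2::nat) ^ rank_of (isotropic_matroid G) S \<le> 2 ^ rank_of (isotropic_matroid G) T"
    using two_power_rank_of_isotropic[OF G] S T by (metis card_mono)
  then show ?thesis by simp
qed

lemma triple_in_span:
  assumes "(Phi v \<in> S \<and> Chi v \<in> S) \<or> (Phi v \<in> S \<and> Psi v \<in> S) \<or> (Chi v \<in> S \<and> Psi v \<in> S)"
  shows "col G (Phi v) \<in> gf2.span (col G ` S)" "col G (Chi v) \<in> gf2.span (col G ` S)"
    "col G (Psi v) \<in> gf2.span (col G ` S)"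
proof -
  have b: "e \<in> S \<Longrightarrow> col G e \<in> gf2.span (col G ` S)" for e
    by (intro gf2.span_base imageI)
  have a: "x \<in> gf2.span (col G ` S) \<Longrightarrow> y \<in> gf2.span (col G ` S) \<Longrightarrow> x + y \<in> gf2.span (col G ` S)"
    for x y by (rule gf2.span_add)
  show "col G (Phi v) \<in> gf2.span (col G ` S)" "col G (Chi v) \<in> gf2.span (col G ` S)"
    "col G (Psi v) \<in> gf2.span (col G ` S)"
    using assms b a col_triple[of G v] by metis+
qed

text \<open>Each triple sums to zero, so a side of a separation that contains two of its elements spans
  the third; replacing \<open>S\<close> by the triples of which it contains the majority increases neither
  rank.\<close>

lemma majority_triples:
  assumes G: "looped_graph G" and S: "S \<subseteq> isotropic_ground G"
  obtains X where "X \<subseteq> verts G"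
    and "rank_of (isotropic_matroid G) (triples X) \<le> rank_of (isotropic_matroid G) S"
    and "rank_of (isotropic_matroid G) (triples (verts G - X)) \<le>
         rank_of (isotropic_matroid G) (isotropic_ground G - S)"
proof
  let ?m = "\<lambda>S v. (Phi v \<in> S \<and> Chi v \<in> S) \<or> (Phi v \<in> S \<and> Psi v \<in> S) \<or> (Chi v \<in> S \<and> Psi v \<in> S)"
  let ?X = "{v \<in> verts G. ?m S v}"
  have span: "col G ` triples Y \<subseteq> gf2.span (col G ` T)" if "\<forall>v\<in>Y. ?m T v" for Y T
  proof (rule image_subsetI)
    fix e assume "e \<in> triples Y"
    then consider v where "v \<in> Y" "e = Phi v" | v where "v \<in> Y" "e = Chi v"
      | v where "v \<in> Y" "e = Psi v" by (auto simp: triples_def)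
    then show "col G e \<in> gf2.span (col G ` T)"
      by cases (use that triple_in_span[of _ T G] in blast)+
  qed
  show "?X \<subseteq> verts G" by auto
  show "rank_of (isotropic_matroid G) (triples ?X) \<le> rank_of (isotropic_matroid G) S"
  proof (rule rank_of_mono_span[OF G _ S span])
    show "triples ?X \<subseteq> isotropic_ground G"
      unfolding isotropic_ground_triples by (rule triples_mono) blast
  qed simp
  show "rank_of (isotropic_matroid G) (triples (verts G - ?X)) \<le>
         rank_of (isotropic_matroid G) (isotropic_ground G - S)"
  proof (rule rank_of_mono_span[OF G _ Diff_subset span])
    show "triples (verts G - ?X) \<subseteq> isotropic_ground G"
      unfolding isotropic_ground_triples by (rule triples_mono) blast
    \<comment> \<open>Of three elements, if at most one lies in \<open>S\<close>, at least two lie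
      in its complement.\<close>
    show "\<forall>v\<in>verts G - ?X. ?m (isotropic_ground G - S) v"
      by (simp add: isotropic_ground_def) blast
  qed
qed

section \<open>Vertical connectivity in terms of nullities\<close>

text \<open>The triples of \<open>X\<close> have connectivity \<open>?k - 1\<close>. By
  \<open>nullity_dual\<close>, each side having rank at least \<open>?k\<close> amounts to its
  nullity being positive.\<close>

lemma vertical_connectivity_le:
  assumes G: "looped_graph G" and X: "X \<subseteq> verts G"
    and pos: "nullity G X > 0" "nullity G (verts G - X) > 0"
  shows "vertical_connectivity (isotropic_matroid G) + nullity G X + nullity G (verts G - X)
    \<le> card (verts G) + 1"
proof -
  let ?M = "isotropic_matroid G" and ?X' = "verts G - X"
  let ?k = "card (verts G) + 1 - nullity G X - nullity G ?X'"
  have le: "nullity G X \<le> card X" "nullity G ?X' \<le> card ?X'"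
    using nullity_le[OF G] X by auto
  note r = rank_of_triples[OF G X] rank_of_triples[OF G Diff_subset, of X] nullity_dual[OF G X]
    card_verts_split[OF G X] rank_of_isotropic_ground[OF G]
  have gr: "isotropic_ground G - triples X = triples ?X'"
    by (simp add: isotropic_ground_triples triples_diff)
  have "vertical_separation ?M ?k (triples X)"
    unfolding vertical_separation_def connectivity_def ground_isotropic_matroid gr
    using r le pos triples_mono[OF X] by (auto simp: isotropic_ground_triples)
  then have "vertical_connectivity ?M \<le> ?k"
    unfolding vertical_connectivity_def by (intro wellorder_Inf_le1) blast
  then show ?thesis using le r by linarith
qed

lemma vertical_connectivity_le_card:
  "looped_graph G \<Longrightarrow> vertical_connectivity (isotropic_matroid G) \<le> card (verts G)"
  unfolding vertical_connectivity_def
  by (intro wellorder_Inf_le1) (simp add: rank_of_isotropic_ground)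

text \<open>Passing to majority triples does not increase the connectivity of a separation attaining
  \<kappa>. The triples may violate the rank bounds for this order, but positive nullities suffice
  for \<open>vertical_connectivity_le\<close>, which forces equality.\<close>

lemma vertical_connectivity_cases:
  assumes G: "looped_graph G"
  obtains "vertical_connectivity (isotropic_matroid G) = card (verts G)"
  | X where "X \<subseteq> verts G" "nullity G X > 0" "nullity G (verts G - X) > 0"
    "vertical_connectivity (isotropic_matroid G) + nullity G X + nullity G (verts G - X) =
      card (verts G) + 1"
proof -
  let ?M = "isotropic_matroid G"
  let ?k = "vertical_connectivity ?M"
  have "?k \<in> {k. \<exists>S. vertical_separation ?M k S} \<union> {rank_of ?M (ground ?M)}"
    unfolding vertical_connectivity_def by (rule Inf_nat_def1) simp
  then consider "?k = card (verts G)" | S where "vertical_separation ?M ?k S"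
    using rank_of_isotropic_ground[OF G] by auto
  then show thesis
  proof cases
    case 1
    then show ?thesis using that by blast
  next
    case 2
    have S: "S \<subseteq> isotropic_ground G" using 2 by (simp add: vertical_separation_def)
    obtain X where X: "X \<subseteq> verts G"
      "rank_of ?M (triples X) \<le> rank_of ?M S"
      "rank_of ?M (triples (verts G - X)) \<le> rank_of ?M (isotropic_ground G - S)"
      using majority_triples[OF G S] by blast
    note r = rank_of_triples[OF G X(1)] rank_of_triples[OF G Diff_subset, of X] nullity_dual[OF G X(1)]
      card_verts_split[OF G X(1)] rank_of_isotropic_ground[OF G]
    have s: "int (rank_of ?M S) + int (rank_of ?M (isotropic_ground G - S)) - int (card (verts G)) < int ?k"
      "?k \<le> rank_of ?M S" "?k \<le> rank_of ?M (isotropic_ground G - S)"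
      using 2 r(5) by (auto simp: vertical_separation_def connectivity_def)
    \<comment> \<open>The separation inequalities put the rank of either side below
      \<open>card (verts G)\<close>; by duality this makes the nullity of the opposite vertex set
      positive.\<close>
    have pos: "nullity G X > 0" "nullity G (verts G - X) > 0"
      using s X(2,3) r(1-4) by linarith+
    have "card (verts G) + 1 \<le> ?k + nullity G X + nullity G (verts G - X)"
      using s(1) X(2,3) r(1-4) by linarith
    then show ?thesis
      using that(2)[OF X(1) pos] vertical_connectivity_le[OF G X(1) pos] by linarith
  qed
qed

section \<open>Connectedness and splits in terms of nullities\<close>

text \<open>Cut-rank zero: every subset of \<open>X\<close> is a word, for which testing singletons
  is enough.\<close>

lemma nullity_eq_card_iff:
  assumes G: "looped_graph G" and X: "X \<subseteq> verts G"
  shows "nullity G X = card X \<longleftrightarrow> (\<forall>v\<in>X. nbrs G v \<subseteq> X)"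
proof
  have fin: "finite X" using finite_subset[OF X finite_verts[OF G]] .
  have sub: "words G X \<subseteq> Pow X" using X by (auto simp: words_iff)
  {
    assume "nullity G X = card X"
    then have "words G X = Pow X"
      using card_words[OF assms] sub fin by (intro card_subset_eq) (auto simp: card_Pow)
    then have "{v} \<in> words G X" if "v \<in> X" for v using that by simp
    then have "nbrs G v \<subseteq> X" if "v \<in> X" for v
      using that X odd_nbrs_single[of v G] words_iff[OF X] by auto
    then show "\<forall>v\<in>X. nbrs G v \<subseteq> X" ..
  }
  {
    assume closed: "\<forall>v\<in>X. nbrs G v \<subseteq> X"
    have "odd_nbrs G Y \<subseteq> X" if "Y \<subseteq> X" for Y
    proof
      fix w assume w: "w \<in> odd_nbrs G Y"
      then have "nbrs G w \<inter> Y \<noteq> {}" by (auto simp: odd_nbrs_def)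
      then obtain y where "y \<in> Y" "y \<in> nbrs G w" by blast
      then show "w \<in> X"
        using nbrs_sym[of w G y] w closed that by (auto simp: odd_nbrs_def)
    qed
    then have "words G X = Pow X" using sub X by (auto simp: words_iff)
    then have "(2::nat) ^ nullity G X = 2 ^ card X"
      using card_words[OF assms] fin by (simp add: card_Pow)
    then show "nullity G X = card X" by simp
  }
qed

text \<open>The set of vertices reachable from a vertex is closed under neighbours, and a path
  cannot leave a closed set.\<close>

lemma connected_graph_iff_closed:
  "connected_graph G \<longleftrightarrow>
    (\<forall>X\<subseteq>verts G. (\<forall>v\<in>X. nbrs G v \<subseteq> X) \<longrightarrow> X = {} \<or> X = verts G)"
proof
  let ?E = "{(x, y). x \<in> verts G \<and> y \<in> nbrs G x}"
  show "\<forall>X\<subseteq>verts G. (\<forall>v\<in>X. nbrs G v \<subseteq> X) \<longrightarrow> X = {} \<or> X = verts G" if con: "connected_graph G"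
  proof (intro allI impI)
    fix X assume X: "X \<subseteq> verts G" "\<forall>v\<in>X. nbrs G v \<subseteq> X"
    show "X = {} \<or> X = verts G"
    proof (rule ccontr)
      assume "\<not> ?thesis"
      then obtain u v where uv: "u \<in> X" "v \<in> verts G" "v \<notin> X" using X(1) by blast
      then have "(u, v) \<in> ?E\<^sup>*" using con X(1) unfolding connected_graph_def by blast
      then have "v \<in> X"
        by (induction rule: rtrancl_induct) (use uv X in auto)
      then show False using uv by blast
    qed
  qed
  show "connected_graph G"
    if closed: "\<forall>X\<subseteq>verts G. (\<forall>v\<in>X. nbrs G v \<subseteq> X) \<longrightarrow> X = {} \<or> X = verts G"
    unfolding connected_graph_def
  proof (intro ballI)
    fix u v assume u: "u \<in> verts G" and v: "v \<in> verts G"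
    let ?R = "{w \<in> verts G. (u, w) \<in> ?E\<^sup>*}"
    have "nbrs G w \<subseteq> ?R" if w: "w \<in> ?R" for w
    proof
      fix x assume x: "x \<in> nbrs G w"
      then have "(w, x) \<in> ?E" using w by blast
      then have "(u, x) \<in> ?E\<^sup>*" using w by (blast intro: rtrancl_into_rtrancl)
      then show "x \<in> ?R" using x nbrs_subset by fast
    qed
    then have "\<forall>w\<in>?R. nbrs G w \<subseteq> ?R" by (rule ballI)
    moreover have "?R \<subseteq> verts G" by (rule Collect_restrict)
    ultimately have "?R = {} \<or> ?R = verts G" using closed[THEN spec, of ?R] by (elim impE) blast+
    moreover have "u \<in> ?R" using u by simp
    ultimately have "?R = verts G" by blast
    then show "(u, v) \<in> ?E\<^sup>*" using v by blast
  qed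
qed

lemma connected_nullity_less:
  assumes "looped_graph G" "connected_graph G" "X \<subseteq> verts G" "X \<noteq> {}" "X \<noteq> verts G"
  shows "nullity G X < card X"
  using assms nullity_le[of G X] nullity_eq_card_iff[of G X]
  by (auto simp: connected_graph_iff_closed order_le_less)

lemma nullity_empty: "nullity G {} = 0"
  by (simp add: nullity_def)

lemma card_coset_image:
  assumes "looped_graph G" "X \<subseteq> verts G"
  shows "card ((\<lambda>Q. odd_nbrs G Q - X) ` Pow X) * 2 ^ nullity G X = 2 ^ card X"
  using card_cosets_words[OF assms] card_words[OF assms] by simp

text \<open>Outside \<open>V1\<close>, a sum of neighbourhoods of vertices of \<open>V1\<close> is
  either empty or \<open>W2\<close>, so the cut-rank is at most one.\<close>

lemma split_nullity:
  assumes G: "looped_graph G" and "is_split G V1 V2 W1 W2"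
  shows "card V1 \<le> nullity G V1 + 1"
proof -
  have V: "V1 \<subseteq> verts G" "V2 = verts G - V1" "W1 \<subseteq> V1" "W2 \<subseteq> V2"
    and W: "\<And>v. v \<in> W1 \<Longrightarrow> nbrs G v \<inter> V2 = W2" "\<And>v. v \<in> V1 - W1 \<Longrightarrow> nbrs G v \<inter> V2 = {}"
    using assms(2) unfolding is_split_def by auto
  have "odd_nbrs G Q - V1 = (if odd (card (Q \<inter> W1)) then W2 else {})" if Q: "Q \<subseteq> V1" for Q
  proof -
    have "nbrs G w \<inter> Q = (if w \<in> W2 then Q \<inter> W1 else {})" if w: "w \<in> V2" for w
    proof -
      have "y \<in> nbrs G w \<longleftrightarrow> w \<in> W2 \<and> y \<in> W1" if "y \<in> Q" for y
        using nbrs_sym_iff[of w G y] that w V W(1)[of y] W(2)[of y] Q by blast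
      then show ?thesis by auto
    qed
    then have "odd (card (nbrs G w \<inter> Q)) \<longleftrightarrow> w \<in> W2 \<and> odd (card (Q \<inter> W1))" if "w \<in> V2" for w
      using that by simp
    moreover have "odd_nbrs G Q - V1 = {w \<in> V2. odd (card (nbrs G w \<inter> Q))}"
      using V(2) by (auto simp: odd_nbrs_def)
    ultimately show ?thesis using V(4) by auto
  qed
  then have "(\<lambda>Q. odd_nbrs G Q - V1) ` Pow V1 \<subseteq> {{}, W2}" by auto
  then have "card ((\<lambda>Q. odd_nbrs G Q - V1) ` Pow V1) \<le> card {{}, W2}" by (intro card_mono) auto
  also have "\<dots> \<le> 2" by (simp add: card_insert_if)
  finally have "2 ^ card V1 \<le> 2 * (2::nat) ^ nullity G V1"
    unfolding card_coset_image[OF G V(1), symmetric] by (rule mult_right_mono) simp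
  then have "(2::nat) ^ card V1 \<le> 2 ^ (nullity G V1 + 1)" by simp
  then show ?thesis by (subst (asm) power_increasing_iff) auto
qed

text \<open>Cut-rank at most one leaves at most one nonempty trace of a neighbourhood outside
  \<open>X\<close>; this trace is the second set of a split.\<close>

lemma nullity_split:
  assumes G: "looped_graph G" and X: "X \<subseteq> verts G"
    and le: "card X \<le> nullity G X + 1" and two: "2 \<le> card X" "2 \<le> card (verts G - X)"
  shows "\<not> prime_graph G"
proof -
  define I where "I = (\<lambda>Q. odd_nbrs G Q - X) ` Pow X"
  have "card I * 2 ^ nullity G X \<le> 2 * 2 ^ nullity G X"
    unfolding I_def card_coset_image[OF G X] using le power_increasing[of "card X" "nullity G X + 1" "2::nat"]
    by simp
  then have "card I \<le> 2" by simp
  moreover have "finite I" using finite_subset[OF X finite_verts[OF G]] by (simp add: I_def)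
  moreover have "{} \<in> I" by (force simp: I_def)
  ultimately have "card (I - {{}}) \<le> Suc 0" "finite (I - {{}})" by auto
  then have one: "\<forall>S\<in>I - {{}}. \<forall>T\<in>I - {{}}. S = T" by (simp only: card_le_Suc0_iff_eq)
  \<comment> \<open>The nonempty member of \<open>I\<close> if there is one, otherwise the empty
    set.\<close>
  obtain W2 where W2: "\<forall>S\<in>I. S = {} \<or> S = W2" "W2 \<in> I"
  proof (cases "I - {{}} = {}")
    case True
    then show ?thesis using that[of "{}"] \<open>{} \<in> I\<close> by blast
  next
    case False
    then obtain W where "W \<in> I - {{}}" by blast
    then show ?thesis using that[of W] one by blast
  qed
  have nb: "nbrs G v - X \<in> I" if "v \<in> X" for v
    unfolding I_def using that X odd_nbrs_single[of v G] by (intro image_eqI[of _ _ "{v}"]) auto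
  have out: "nbrs G v \<inter> (verts G - X) = nbrs G v - X" for v using nbrs_subset[of G v] by blast
  let ?W1 = "{v \<in> X. nbrs G v - X = W2}"
  have 1: "W2 \<subseteq> verts G - X" using W2(2) odd_nbrs_subset[of G] by (auto simp: I_def)
  have 2: "\<forall>v\<in>?W1. nbrs G v \<inter> (verts G - X) = W2" unfolding out by simp
  have "nbrs G v - X = {}" if "v \<in> X - ?W1" for v
    using that nb[of v] bspec[OF W2(1), of "nbrs G v - X"] by simp
  then have 3: "\<forall>v\<in>X - ?W1. nbrs G v \<inter> (verts G - X) = {}" unfolding out by (rule ballI)
  have 4: "X \<union> (verts G - X) = verts G" "X \<inter> (verts G - X) = {}" "?W1 \<subseteq> X" using X by auto
  have "is_split G X (verts G - X) ?W1 W2"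
    unfolding is_split_def using 1 2 3 4 two by (intro conjI) assumption+
  then show ?thesis unfolding prime_graph_def by blast
qed

lemma nullity_pos:
  assumes G: "looped_graph G" and X: "X \<subseteq> verts G" and Y: "Y \<in> words G X" "Y \<noteq> {}"
  shows "nullity G X > 0"
proof -
  have "{{}, Y} \<subseteq> words G X" using Y(1) empty_in_words by blast
  then have "card {{}, Y} \<le> card (words G X)" by (rule card_mono[OF finite_words[OF G]])
  then have "2 \<le> (2::nat) ^ nullity G X" using card_words[OF G X] Y(2) by simp
  then show ?thesis by (cases "nullity G X") auto
qed

text \<open>A closed set with two vertices on each side is a split without crossing edges. If the
  closed set is a single isolated vertex, it forms a split side together with any second
  vertex.\<close>

lemma disconnected_not_prime:
  assumes G: "looped_graph G" and con: "\<not> connected_graph G" and n: "4 \<le> card (verts G)"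
  shows "\<not> prime_graph G"
proof -
  obtain X where X: "X \<subseteq> verts G" "X \<noteq> {}" "X \<noteq> verts G" "nullity G X = card X"
    using con nullity_eq_card_iff[OF G] unfolding connected_graph_iff_closed by blast
  note fin = finite_verts[OF G]
  \<comment> \<open>One of \<open>X\<close> and its complement has two or more vertices;
    interchanging them if necessary, it is the complement.\<close>
  have "\<exists>X\<subseteq>verts G. nullity G X = card X \<and> X \<noteq> {} \<and> 2 \<le> card (verts G - X)"
  proof (cases "2 \<le> card (verts G - X)")
    case True
    then show ?thesis using X by blast
  next
    case False
    have "nullity G (verts G - X) = card (verts G - X)" using nullity_dual[OF G X(1)] X(4) by simp
    moreover have "verts G - (verts G - X) = X" using X(1) by blast
    moreover have "card X \<ge> 2" using card_verts_split[OF G X(1)] False n by linarith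
    ultimately show ?thesis using X by (intro exI[of _ "verts G - X"]) auto
  qed
  then obtain X where X: "X \<subseteq> verts G" "nullity G X = card X" "X \<noteq> {}" "2 \<le> card (verts G - X)"
    by blast
  show ?thesis
  proof (cases "2 \<le> card X")
    case True
    then show ?thesis using nullity_split[OF G X(1)] X by simp
  next
    case False
    have "card X > 0" using X fin finite_subset by (metis card_gt_0_iff)
    then have "card X = 1" using False by linarith
    then obtain v where v: "X = {v}" by (rule card_1_singletonE)
    obtain u where u: "u \<in> verts G" "u \<noteq> v"
      using X(4) v by (metis Diff_iff card.empty equals0I insertI1 not_numeral_le_zero)
    let ?Y = "{u, v}"
    have Y: "?Y \<subseteq> verts G" "card ?Y = 2" using u X(1) v by auto
    have "nbrs G v = {}" using nullity_eq_card_iff[OF G X(1)] X(2) v nbrs_irrefl[of v G] by auto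
    \<comment> \<open>The isolated vertex is a word of weight one, so the pair \<open>?Y\<close> has
      nullity at least one and cut-rank at most one.\<close>
    then have "{v} \<in> words G ?Y" using Y X(1) v by (simp add: words_iff odd_nbrs_single)
    then have "nullity G ?Y > 0" using nullity_pos[OF G Y(1)] by blast
    then show ?thesis
      using nullity_split[OF G Y(1)] Y(2) card_verts_split[OF G Y(1)] n by linarith
  qed
qed

section \<open>Small vertical connectivity\<close>

text \<open>A proper nonempty closed set has cut-rank zero and yields a separation of order one;
  order zero is excluded by \<open>nullity_le\<close>.\<close>

lemma vertical_connectivity_disconnected:
  assumes G: "looped_graph G" and con: "\<not> connected_graph G"
  shows "vertical_connectivity (isotropic_matroid G) = 1"
proof -
  let ?k = "vertical_connectivity (isotropic_matroid G)"
  obtain X where X: "X \<subseteq> verts G" "X \<noteq> {}" "X \<noteq> verts G" "nullity G X = card X"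
    using con nullity_eq_card_iff[OF G] unfolding connected_graph_iff_closed by blast
  note fin = finite_verts[OF G]
  have pos: "card X > 0" "card (verts G - X) > 0"
    using X fin finite_subset[OF X(1)] by (auto simp: card_gt_0_iff)
  have dual: "nullity G (verts G - X) = card (verts G - X)" using nullity_dual[OF G X(1)] X(4) by simp
  have "?k \<le> 1"
    using vertical_connectivity_le[OF G X(1)] pos X(4) dual card_verts_split[OF G X(1)] by linarith
  moreover have "?k \<ge> 1"
  proof (rule vertical_connectivity_cases[OF G])
    assume "?k = card (verts G)"
    then show ?thesis using card_verts_split[OF G X(1)] pos by linarith
  next
    fix X assume "X \<subseteq> verts G" "?k + nullity G X + nullity G (verts G - X) = card (verts G) + 1"
    then show ?thesis
      using nullity_le[OF G, of X] nullity_le[OF G Diff_subset, of X] card_verts_split[OF G, of X]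
      by linarith
  qed
  ultimately show ?thesis by linarith
qed

text \<open>Here \<open>c\<close> is the cut-rank of \<open>X\<close>, positive by connectedness.
  Since both nullities are positive, each side has at least \<open>c + 1\<close> vertices, which
  gives the size bounds.\<close>

lemma connected_vertical_connectivity_cases:
  assumes G: "looped_graph G" and con: "connected_graph G"
  obtains "vertical_connectivity (isotropic_matroid G) = card (verts G)"
  | X c where "X \<subseteq> verts G" "card X = nullity G X + c" "2 \<le> card X" "2 \<le> card (verts G - X)" "c > 0"
    "vertical_connectivity (isotropic_matroid G) = 2 * c + 1" "2 * c + 2 \<le> card (verts G)"
proof (rule vertical_connectivity_cases[OF G])
  let ?k = "vertical_connectivity (isotropic_matroid G)"
  {
    assume "?k = card (verts G)"
    then show thesis by (rule that)
  next
    fix X assume X: "X \<subseteq> verts G" "nullity G X > 0" "nullity G (verts G - X) > 0"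
      "?k + nullity G X + nullity G (verts G - X) = card (verts G) + 1"
    have ne: "X \<noteq> {}" "X \<noteq> verts G" using X nullity_empty[of G] by auto
    have less: "nullity G X < card X" using connected_nullity_less[OF G con X(1) ne] .
    note a = X(2-4) less nullity_dual[OF G X(1)] card_verts_split[OF G X(1)]
    show thesis
      by (rule that(2)[of X "card X - nullity G X"]) (use a X(1) in linarith)+
  }
qed

lemma vertical_connectivity_small:
  assumes "looped_graph G" "connected_graph G" "card (verts G) \<le> 3"
  shows "vertical_connectivity (isotropic_matroid G) = card (verts G)"
  by (rule connected_vertical_connectivity_cases[OF assms(1,2)]) (use assms(3) in auto)

text \<open>A split has cut-rank at most one and so bounds \<kappa> by three; connectedness makes
  every relevant cut-rank at least one.\<close>

lemma vertical_connectivity_split: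
  assumes G: "looped_graph G" and con: "connected_graph G" and n: "card (verts G) \<ge> 4"
    and np: "\<not> prime_graph G"
  shows "vertical_connectivity (isotropic_matroid G) = 3"
proof -
  let ?k = "vertical_connectivity (isotropic_matroid G)"
  obtain V1 V2 W1 W2 where s: "is_split G V1 V2 W1 W2" using np by (auto simp: prime_graph_def)
  then have V: "V1 \<subseteq> verts G" "V2 = verts G - V1" "card V1 \<ge> 2" "card V2 \<ge> 2"
    by (auto simp: is_split_def)
  have "?k + nullity G V1 + nullity G V2 \<le> card (verts G) + 1"
    using vertical_connectivity_le[OF G V(1)] V split_nullity[OF G s] nullity_dual[OF G V(1)] by simp
  then have "?k \<le> 3"
    using V split_nullity[OF G s] nullity_dual[OF G V(1)] card_verts_split[OF G V(1)] by simp
  moreover have "?k \<ge> 3"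
    by (rule connected_vertical_connectivity_cases[OF G con]) (use n in linarith)+
  ultimately show ?thesis by linarith
qed

text \<open>Primeness rules out cut-rank one, so a separation attaining \<kappa> has
  \<open>c\<close> at least two, and then \<open>2 * c + 2\<close> is at least six.\<close>

lemma vertical_connectivity_prime:
  assumes G: "looped_graph G" and n: "card (verts G) \<ge> 4" and p: "prime_graph G"
  shows "vertical_connectivity (isotropic_matroid G) = card (verts G) \<or>
    odd (vertical_connectivity (isotropic_matroid G)) \<and>
    vertical_connectivity (isotropic_matroid G) \<ge> 5 \<and> card (verts G) \<ge> 6"
proof -
  have con: "connected_graph G" using disconnected_not_prime[OF G _ n] p by blast
  show ?thesis
  proof (rule connected_vertical_connectivity_cases[OF G con])
    fix X c
    assume X: "X \<subseteq> verts G" "card X = nullity G X + c" "2 \<le> card X" "2 \<le> card (verts G - X)" "c > 0"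
      "vertical_connectivity (isotropic_matroid G) = 2 * c + 1" "2 * c + 2 \<le> card (verts G)"
    have "\<not> card X \<le> nullity G X + 1" using nullity_split[OF G X(1) _ X(3,4)] p by blast
    then have "c \<ge> 2" using X(2) by linarith
    then show ?thesis using X(6,7) by simp
  qed simp
qed

section \<open>Graphs of maximal vertical connectivity\<close>

definition extremal_graph :: "'a graph \<Rightarrow> bool" where
  "extremal_graph G \<longleftrightarrow> (\<forall>Y\<subseteq>verts G. Y \<noteq> {} \<longrightarrow> card (verts G) < 2 * card (supp G Y))"

lemma supp_subset: "Y \<subseteq> verts G \<Longrightarrow> supp G Y \<subseteq> verts G"
  using odd_nbrs_subset[of G Y] by (simp add: supp_def)

text \<open>The support of a light word has positive nullity, and so has its complement, which is at
  least as large. The separation they form has order below \<open>card (verts G)\<close>.\<close>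

lemma extremal_if_vertical_connectivity:
  assumes G: "looped_graph G"
    and k: "vertical_connectivity (isotropic_matroid G) = card (verts G)"
  shows "extremal_graph G"
  unfolding extremal_graph_def
proof (intro allI impI, rule ccontr)
  fix Y assume Y: "Y \<subseteq> verts G" "Y \<noteq> {}" and "\<not> card (verts G) < 2 * card (supp G Y)"
  then have le: "2 * card (supp G Y) \<le> card (verts G)" by simp
  let ?X = "supp G Y"
  have X: "?X \<subseteq> verts G" using supp_subset[OF Y(1)] .
  have pos: "nullity G ?X > 0"
    using nullity_pos[OF G X _ Y(2)] Y(1) by (simp add: words_def)
  then have pos': "nullity G (verts G - ?X) > 0"
    using nullity_dual[OF G X] card_verts_split[OF G X] le by linarith
  show False using vertical_connectivity_le[OF G X pos pos'] k pos pos' by linarith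
qed

text \<open>The complement of \<open>X\<close> has at most half of the vertices and supports only
  the empty word; duality then determines the nullity of \<open>X\<close>.\<close>

lemma extremal_card_words:
  assumes G: "looped_graph G" and ex: "extremal_graph G" and X: "X \<subseteq> verts G"
    and n: "card (verts G) \<le> 2 * card X"
  shows "card (words G X) = 2 ^ (2 * card X - card (verts G))"
proof -
  let ?X' = "verts G - X"
  have "Y = {}" if Y: "Y \<in> words G ?X'" for Y
  proof (rule ccontr)
    assume "Y \<noteq> {}"
    then have "card (verts G) < 2 * card (supp G Y)"
      using ex Y by (auto simp: extremal_graph_def words_def)
    moreover have "card (supp G Y) \<le> card ?X'"
      using Y finite_verts[OF G] by (intro card_mono) (auto simp: words_def)
    ultimately show False using n card_verts_split[OF G X] by linarith
  qed
  then have "words G ?X' = {{}}" using empty_in_words[of G ?X'] by blast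
  then have "(2::nat) ^ nullity G ?X' = 2 ^ 0" using card_words[OF G Diff_subset, of X] by simp
  then have "nullity G ?X' = 0" by (subst (asm) power_inject_exp) auto
  then show ?thesis
    using card_words[OF G X] nullity_dual[OF G X] card_verts_split[OF G X] n by simp
qed

text \<open>The handshake lemma in the subgraph induced on \<open>Y\<close>, by adding one vertex at
  a time.\<close>

lemma even_sum_card_nbrs:
  assumes G: "looped_graph G" and Y: "Y \<subseteq> verts G"
  shows "even (\<Sum>y\<in>Y. card (nbrs G y \<inter> Y))"
  using finite_subset[OF Y finite_verts[OF G]] Y
proof (induction Y rule: finite_induct)
  case (insert v Y)
  have fin: "finite (nbrs G w)" for w by (rule finite_nbrs[OF G])
  have c: "card (nbrs G w \<inter> insert v Y) = card (nbrs G w \<inter> {v}) + card (nbrs G w \<inter> Y)" for w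
    using fin insert.hyps by (subst card_Un_disjoint[symmetric]) (auto intro: arg_cong[of _ _ card])
  have "(\<Sum>y\<in>Y. card (nbrs G y \<inter> {v})) = card (nbrs G v \<inter> Y)"
    using sum_card_nbrs[OF G, of "{v}" Y] insert.prems by simp
  then have "(\<Sum>y\<in>insert v Y. card (nbrs G y \<inter> insert v Y)) =
      2 * card (nbrs G v \<inter> Y) + (\<Sum>y\<in>Y. card (nbrs G y \<inter> Y))"
    unfolding c using insert.hyps by (simp add: sum.distrib)
  then show ?case using insert by simp
qed simp

text \<open>By the handshake lemma an even number of vertices of \<open>Y\<close> have odd degree
  within \<open>Y\<close>. So the intersection of \<open>Y\<close> and \<open>odd_nbrs G Y\<close>
  does not affect the parity of the union.\<close>

lemma odd_card_supp:
  assumes G: "looped_graph G" and Y: "Y \<subseteq> verts G"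
  shows "odd (card (supp G Y)) \<longleftrightarrow> odd (card Y) \<noteq> odd (card (odd_nbrs G Y))"
proof -
  have fin: "finite Y" "finite (odd_nbrs G Y)"
    using finite_subset[OF _ finite_verts[OF G]] Y odd_nbrs_subset[of G] by auto
  have "even (card {y \<in> Y. odd (card (nbrs G y \<inter> Y))})"
    using even_sum_card_nbrs[OF assms] even_sum_iff[OF fin(1), of "\<lambda>y. card (nbrs G y \<inter> Y)"]
    by (rule iffD1[rotated])
  moreover have "{y \<in> Y. odd (card (nbrs G y \<inter> Y))} = Y \<inter> odd_nbrs G Y"
    using Y by (auto simp: odd_nbrs_def)
  ultimately have "even (card (Y \<inter> odd_nbrs G Y))" by simp
  then show ?thesis
    using card_Un_Int[OF fin] unfolding supp_def by presburger
qed

lemma odd_card_supp_sym_diff: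
  assumes G: "looped_graph G" and Y: "Y \<subseteq> verts G" and Z: "Z \<subseteq> verts G"
  shows "odd (card (supp G (sym_diff Y Z))) \<longleftrightarrow> odd (card (supp G Y)) \<noteq> odd (card (supp G Z))"
proof -
  have fin: "finite S" if "S \<subseteq> verts G" for S using finite_subset[OF that finite_verts[OF G]] .
  have "sym_diff Y Z \<subseteq> verts G" using Y Z by blast
  from odd_card_supp[OF G this]
  have "odd (card (supp G (sym_diff Y Z))) \<longleftrightarrow>
      odd (card (sym_diff Y Z)) \<noteq> odd (card (sym_diff (odd_nbrs G Y) (odd_nbrs G Z)))"
    unfolding odd_nbrs_sym_diff[OF G] .
  also have "\<dots> \<longleftrightarrow> (odd (card Y) \<noteq> odd (card Z)) \<noteq>
      (odd (card (odd_nbrs G Y)) \<noteq> odd (card (odd_nbrs G Z)))"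
    unfolding odd_card_sym_diff[OF fin[OF Y] fin[OF Z]]
      odd_card_sym_diff[OF fin[OF odd_nbrs_subset] fin[OF odd_nbrs_subset]] ..
  finally show ?thesis
    unfolding odd_card_supp[OF G Y] odd_card_supp[OF G Z] by argo
qed

text \<open>The parity of the weight is a linear functional: adding one odd word \<open>Z\<close>
  exchanges the even and the odd words.\<close>

lemma card_even_words:
  assumes G: "looped_graph G"
  defines "E X \<equiv> {Y \<in> words G X. even (card (supp G Y))}"
  shows "card (E X) = card (words G X) \<or> 2 * card (E X) = card (words G X)"
proof (cases "E X = words G X")
  case False
  then obtain Z where Z: "Z \<in> words G X" "odd (card (supp G Z))" by (auto simp: E_def)
  have V: "Y \<subseteq> verts G" if "Y \<in> words G X" for Y using that by (simp add: words_def)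
  have flip: "sym_diff Z Y \<in> words G X"
    "odd (card (supp G (sym_diff Z Y))) \<longleftrightarrow> even (card (supp G Y))" if "Y \<in> words G X" for Y
    using words_sym_diff[OF G Z(1) that] odd_card_supp_sym_diff[OF G V[OF Z(1)] V[OF that]] Z(2)
    by auto
  have "bij_betw (\<lambda>Y. sym_diff Z Y) (E X) (words G X - E X)"
  proof (rule bij_betw_byWitness[where f' = "\<lambda>Y. sym_diff Z Y"])
    show "(\<lambda>Y. sym_diff Z Y) ` E X \<subseteq> words G X - E X"
      using flip by (auto simp: E_def)
    show "(\<lambda>Y. sym_diff Z Y) ` (words G X - E X) \<subseteq> E X"
      using flip by (auto simp: E_def)
  qed (simp_all only: sym_diff_cancel, simp_all)
  then have "card (E X) = card (words G X - E X)" by (rule bij_betw_same_card)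
  moreover have "card (words G X - E X) = card (words G X) - card (E X)"
    using finite_words[OF G] by (intro card_Diff_subset) (auto simp: E_def)
  moreover have "card (E X) \<le> card (words G X)"
    using finite_words[OF G] by (intro card_mono) (auto simp: E_def)
  ultimately show ?thesis by linarith
qed simp

text \<open>Three vertices would support four words, the nonempty ones of weight exactly three. Only
  the empty word is then even, but at least half of the words must be.\<close>

lemma extremal_card_ne_4:
  assumes G: "looped_graph G" and ex: "extremal_graph G"
  shows "card (verts G) \<noteq> 4"
proof
  assume n: "card (verts G) = 4"
  then obtain X where X: "X \<subseteq> verts G" "card X = 3"
    using obtain_subset_with_card_n[of 3 "verts G"] by auto
  have w: "card (words G X) = 4" using extremal_card_words[OF G ex X(1)] X n by simp
  have "Y = {}" if Y: "Y \<in> words G X" "even (card (supp G Y))" for Y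
  proof (rule ccontr)
    assume "Y \<noteq> {}"
    then have "4 < 2 * card (supp G Y)" using ex Y n by (auto simp: extremal_graph_def words_def)
    moreover have "card (supp G Y) \<le> 3"
      using Y X finite_subset[OF X(1) finite_verts[OF G]] card_mono[of X "supp G Y"]
      by (auto simp: words_def)
    ultimately have "card (supp G Y) = 3" by linarith
    then show False using Y(2) by simp
  qed
  then have "{Y \<in> words G X. even (card (supp G Y))} = {{}}"
    using empty_in_words[of G X] by (auto simp: supp_def)
  then show False using card_even_words[OF G, of X] w by simp
qed

text \<open>In an extremal graph on \<open>2 * m + 1\<close> vertices, \<open>m + 1\<close> is the
  least weight a nonempty word can have.\<close>

definition min_words :: "'a graph \<Rightarrow> nat \<Rightarrow> 'a set \<Rightarrow> 'a set set" where
  "min_words G m X = {Y \<in> words G X. card (supp G Y) = m + 1}"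

text \<open>Each set of \<open>m + 1\<close> vertices supports exactly two words, and the nonempty
  one must fill it. Supports thus match the words of this weight with the subsets of size
  \<open>m + 1\<close>.\<close>

lemma extremal_card_min_words:
  assumes G: "looped_graph G" and ex: "extremal_graph G" and n: "card (verts G) = 2 * m + 1"
    and X: "X \<subseteq> verts G"
  shows "card (min_words G m X) = card X choose (m + 1)"
proof -
  have finX: "finite X" using finite_subset[OF X finite_verts[OF G]] .
  have unique: "\<exists>!Y. Y \<subseteq> verts G \<and> supp G Y = S" if S: "S \<subseteq> X" "card S = m + 1" for S
  proof -
    have SV: "S \<subseteq> verts G" using S X by blast
    have fS: "finite S" using finite_subset[OF S(1) finX] .
    have two: "card (words G S) = 2" using extremal_card_words[OF G ex SV] S n by simp
    then have "words G S \<noteq> {{}}" by (metis card_1_singleton_iff One_nat_def n_not_Suc_n numeral_2_eq_2)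
    then obtain Y where Y: "Y \<in> words G S" "Y \<noteq> {}" using empty_in_words[of G S] by blast
    have YV: "Y \<subseteq> verts G" and YS: "supp G Y \<subseteq> S" using Y(1) by (auto simp: words_def)
    have "2 * m + 1 < 2 * card (supp G Y)"
      using ex YV Y(2) n unfolding extremal_graph_def by metis
    then have eq: "supp G Y = S" using S(2) by (intro card_seteq[OF fS YS]) linarith
    show ?thesis
    proof (rule ex1I[of _ Y])
      show "Y \<subseteq> verts G \<and> supp G Y = S" using Y eq by (simp add: words_def)
      fix Z assume Z: "Z \<subseteq> verts G \<and> supp G Z = S"
      then have "Z \<noteq> {}" using S by (auto simp: supp_def)
      show "Z = Y"
      proof (rule ccontr)
        assume "Z \<noteq> Y"
        then have "card {{}, Y, Z} = 3" using \<open>Z \<noteq> {}\<close> Y by auto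
        moreover have "{{}, Y, Z} \<subseteq> words G S" using Y(1) Z empty_in_words[of G S] by (auto simp: words_def)
        then have "card {{}, Y, Z} \<le> card (words G S)" by (rule card_mono[OF finite_words[OF G]])
        ultimately show False using two by linarith
      qed
    qed
  qed
  have "bij_betw (supp G) (min_words G m X) {S. S \<subseteq> X \<and> card S = m + 1}"
  proof (rule bij_betwI')
    fix Y Z assume "Y \<in> min_words G m X" "Z \<in> min_words G m X"
    then have "Y \<subseteq> verts G" "Z \<subseteq> verts G" "supp G Y \<subseteq> X" "card (supp G Y) = m + 1"
      by (simp_all add: min_words_def words_def)
    then show "supp G Y = supp G Z \<longleftrightarrow> Y = Z"
      using unique[of "supp G Y"] by metis
  next
    fix Y assume "Y \<in> min_words G m X"
    then show "supp G Y \<in> {S. S \<subseteq> X \<and> card S = m + 1}" by (simp add: min_words_def words_def)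
  next
    fix S assume "S \<in> {S. S \<subseteq> X \<and> card S = m + 1}"
    then have S: "S \<subseteq> X" "card S = m + 1" by simp_all
    then obtain Y where Y: "Y \<subseteq> verts G" "supp G Y = S" using unique[of S] by blast
    then have "Y \<in> min_words G m X" using S by (simp add: min_words_def words_def)
    then show "\<exists>Y\<in>min_words G m X. S = supp G Y" using Y(2) by blast
  qed
  then show ?thesis using n_subsets[OF finX] by (simp add: bij_betw_same_card)
qed

lemma finite_min_words: "looped_graph G \<Longrightarrow> finite (min_words G m X)"
  unfolding min_words_def by (rule finite_subset[OF Collect_restrict finite_words])

lemma empty_notin_min_words: "{} \<notin> min_words G m X"
  by (simp add: min_words_def supp_def)

text \<open>Here the parity count of \<open>extremal_odd_card\<close> below is inconclusive. In a set of nine vertices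
  the 84 words of weight six force all 128 words to be even, hence the other nonempty ones to have
  weight eight; the resulting number of zeros contradicts counting them coordinate by coordinate.\<close>

lemma extremal_card_ne_11:
  assumes G: "looped_graph G" and ex: "extremal_graph G"
  shows "card (verts G) \<noteq> 11"
proof
  assume n: "card (verts G) = 11"
  then obtain X where X: "X \<subseteq> verts G" "card X = 9"
    using obtain_subset_with_card_n[of 9 "verts G"] by auto
  have finX: "finite X" using finite_subset[OF X(1) finite_verts[OF G]] .
  let ?W = "words G X" and ?M = "min_words G 5 X"
  let ?E = "{Y \<in> ?W. even (card (supp G Y))}"
  have w: "card ?W = 128" using extremal_card_words[OF G ex X(1)] X n by simp
  have "(9::nat) choose 6 = 84" by code_simp
  then have M: "card ?M = 84" using extremal_card_min_words[OF G ex, of 5 X] X n by simp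
  have MW: "insert {} ?M \<subseteq> ?W"
    using empty_in_words[of G X] unfolding min_words_def by blast
  have finM: "finite ?M" by (rule finite_min_words[OF G])
  have M1: "card (insert {} ?M) = 85" using M finM empty_notin_min_words[of G 5 X] by simp
  have "even (card (supp G Y))" if "Y \<in> insert {} ?M" for Y
    using that by (auto simp: min_words_def supp_def)
  then have "insert {} ?M \<subseteq> ?E" using MW by blast
  then have "85 \<le> card ?E" using M1 card_mono[of ?E "insert {} ?M"] finite_words[OF G] by simp
  then have "card ?E = card ?W" using card_even_words[OF G, of X] w by linarith
  then have "?E = ?W" by (intro card_subset_eq finite_words[OF G]) auto
  then have even: "even (card (supp G Y))" if "Y \<in> ?W" for Y using that by blast
  have codim: "card {x \<in> X. x \<notin> supp G Y} = 9 - card (supp G Y)" "card (supp G Y) \<le> 9"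
    if "Y \<in> ?W" for Y
  proof -
    have s: "supp G Y \<subseteq> X" using that by (simp add: words_def)
    have "{x \<in> X. x \<notin> supp G Y} = X - supp G Y" by auto
    then show "card {x \<in> X. x \<notin> supp G Y} = 9 - card (supp G Y)"
      using s X finX finite_subset[OF s] by (simp add: card_Diff_subset)
    show "card (supp G Y) \<le> 9" using card_mono[OF finX s] X by simp
  qed
  have rest: "card {x \<in> X. x \<notin> supp G Y} = 1" if Y: "Y \<in> ?W - insert {} ?M" for Y
  proof -
    have "11 < 2 * card (supp G Y)"
      using Y ex n by (auto simp: extremal_graph_def words_def)
    moreover have "card (supp G Y) \<noteq> 6" using Y by (auto simp: min_words_def)
    moreover have "card (supp G Y) \<le> 9" "even (card (supp G Y))" using codim(2) even Y by auto
    ultimately have "card (supp G Y) = 8" by presburger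
    then show ?thesis using codim(1) Y by simp
  qed
  \<comment> \<open>Pairs of a word and a vertex of \<open>X\<close> outside its support: by
    vertices there are 9 * 32 = 288, by words 43 + 9 + 84 * 3 = 304.\<close>
  have "(\<Sum>Y\<in>?W. card {x \<in> X. x \<notin> supp G Y}) = (\<Sum>x\<in>X. 32)"
  proof (rule sum_multicount_gen[OF finite_words[OF G] finX], rule ballI)
    fix x assume x: "x \<in> X"
    have "{Y \<in> ?W. x \<notin> supp G Y} = words G (X - {x})" by (auto simp: words_def)
    moreover have "card (X - {x}) = 8" using x X finX by simp
    ultimately show "card {Y \<in> ?W. x \<notin> supp G Y} = 32"
      using extremal_card_words[OF G ex, of "X - {x}"] X n by auto
  qed
  moreover have "(\<Sum>Y\<in>?W. card {x \<in> X. x \<notin> supp G Y}) =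
      (\<Sum>Y\<in>?W - insert {} ?M. card {x \<in> X. x \<notin> supp G Y}) +
      (\<Sum>Y\<in>insert {} ?M. card {x \<in> X. x \<notin> supp G Y})"
    using MW finite_words[OF G] by (intro sum.subset_diff)
  moreover have "(\<Sum>Y\<in>?W - insert {} ?M. card {x \<in> X. x \<notin> supp G Y}) = 43"
    using rest w M1 MW finM by (simp add: card_Diff_subset)
  moreover have "(\<Sum>Y\<in>insert {} ?M. card {x \<in> X. x \<notin> supp G Y}) = 9 + 84 * 3"
  proof -
    have "(\<Sum>Y\<in>?M. card {x \<in> X. x \<notin> supp G Y}) = (\<Sum>Y\<in>?M. 3)"
      using codim(1) by (intro sum.cong refl) (auto simp: min_words_def)
    moreover have "{x \<in> X. x \<notin> supp G {}} = X" by (auto simp: supp_def)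
    ultimately show ?thesis using M finM X empty_notin_min_words[of G 5 X] by simp
  qed
  ultimately show False using X by simp
qed

text \<open>A set of \<open>m + 2\<close> vertices supports eight words: the empty one, exactly \<open>m + 2\<close> of weight
  \<open>m + 1\<close>, and the remaining \<open>5 - m\<close> of weight \<open>m + 2\<close>. Parity of the weight being additive,
  the even ones number four or eight, which leaves only \<open>m \<in> {1, 2, 5}\<close>.\<close>

lemma extremal_odd_card:
  assumes G: "looped_graph G" and ex: "extremal_graph G" and n: "card (verts G) = 2 * m + 1"
  shows "m < 3"
proof (rule ccontr)
  assume m: "\<not> m < 3"
  then obtain X where X: "X \<subseteq> verts G" "card X = m + 2"
    using obtain_subset_with_card_n[of "m + 2" "verts G"] n by auto
  have finX: "finite X" using finite_subset[OF X(1) finite_verts[OF G]] .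
  let ?W = "words G X" and ?M = "min_words G m X"
  let ?E = "{Y \<in> ?W. even (card (supp G Y))}"
  have w: "card ?W = 8" using extremal_card_words[OF G ex X(1)] X n by simp
  have M: "card ?M = m + 2" using extremal_card_min_words[OF G ex n X(1)] X by simp
  have MW: "insert {} ?M \<subseteq> ?W"
    using empty_in_words[of G X] unfolding min_words_def by blast
  have finM: "finite ?M" by (rule finite_min_words[OF G])
  have M1: "card (insert {} ?M) = m + 3" using M finM empty_notin_min_words[of G m X] by simp
  have "m + 3 \<le> 8" using card_mono[OF finite_words[OF G] MW] M1 w by simp
  moreover have "m \<noteq> 5" using extremal_card_ne_11[OF G ex] n by auto
  ultimately have m34: "m = 3 \<or> m = 4" using m by linarith
  have weight: "card (supp G Y) = m + 2" if Y: "Y \<in> ?W - insert {} ?M" for Y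
  proof -
    have "2 * m + 1 < 2 * card (supp G Y)"
      using Y ex n by (auto simp: extremal_graph_def words_def)
    moreover have "card (supp G Y) \<noteq> m + 1" using Y by (auto simp: min_words_def)
    moreover have "card (supp G Y) \<le> m + 2"
      using card_mono[OF finX, of "supp G Y"] Y X by (auto simp: words_def)
    ultimately show ?thesis by linarith
  qed
  have Mweight: "card (supp G Y) = m + 1" if "Y \<in> ?M" for Y using that by (simp add: min_words_def)
  have s0: "card (supp G {}) = 0" by (simp add: supp_def)
  have parity: "even (card (supp G Y)) \<longleftrightarrow> Y = {} \<or> (Y \<in> ?M \<longleftrightarrow> odd m)" if "Y \<in> ?W" for Y
    using that weight[of Y] Mweight[of Y] s0 by (cases "Y = {}"; cases "Y \<in> ?M") simp_all
  \<comment> \<open>For \<open>m = 3\<close> there are 1 + 5 = 6 even words, for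
    \<open>m = 4\<close> there are 8 - 6 = 2; neither number is four or eight.\<close>
  from m34 show False
  proof
    assume m: "m = 3"
    then have "even (card (supp G Y)) \<longleftrightarrow> Y \<in> insert {} ?M" if "Y \<in> ?W" for Y
      using parity[OF that] by simp
    then have "?E = insert {} ?M" using MW by blast
    then have "card ?E = 6" using M1 m by simp
    then show False using card_even_words[OF G, of X] w by simp
  next
    assume m: "m = 4"
    then have "even (card (supp G Y)) \<longleftrightarrow> Y \<notin> ?M" if "Y \<in> ?W" for Y
      using parity[OF that] empty_notin_min_words[of G m X] by auto
    then have "?E = ?W - ?M" by blast
    then have "card ?E = 2" using M w m MW finM by (simp add: card_Diff_subset)
    then show False using card_even_words[OF G, of X] w by simp
  qed
qed

section \<open>Local complementation\<close>

lemma verts_toggle_edges [simp]: "verts (toggle_edges F G) = verts G"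
  by (simp add: toggle_edges_def)

lemma edges_toggle_edges: "e \<in> edges (toggle_edges F G) \<longleftrightarrow> (e \<in> edges G) \<noteq> (e \<in> F)"
  by (auto simp: toggle_edges_def)

lemma verts_loop_complement [simp]: "verts (loop_complement G v) = verts G"
  by (simp add: loop_complement_def)

lemma verts_slc [simp]: "verts (simple_local_complement G v) = verts G"
  by (simp add: simple_local_complement_def)

lemma looped_toggle_edges:
  assumes "looped_graph G" "\<And>e. e \<in> F \<Longrightarrow> \<exists>u\<in>verts G. \<exists>v\<in>verts G. e = {u, v}"
  shows "looped_graph (toggle_edges F G)"
proof -
  have "\<exists>u\<in>verts G. \<exists>v\<in>verts G. e = {u, v}" if "e \<in> edges (toggle_edges F G)" for e
    using that assms edges_toggle_edges[of e F G] unfolding looped_graph_def by (cases "e \<in> F") auto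
  then show ?thesis using assms(1) by (simp add: looped_graph_def)
qed

lemma looped_loop_complement:
  assumes "looped_graph G" "v \<in> verts G"
  shows "looped_graph (loop_complement G v)"
  unfolding loop_complement_def using assms(2) by (intro looped_toggle_edges[OF assms(1)]) auto

lemma looped_slc:
  assumes "looped_graph G"
  shows "looped_graph (simple_local_complement G v)"
  unfolding simple_local_complement_def
  using nbrs_subset[of G v] by (intro looped_toggle_edges[OF assms]) auto

lemma nbrs_loop_complement: "nbrs (loop_complement G v) = nbrs G"
  by (auto simp: fun_eq_iff nbrs_def loop_complement_def edges_toggle_edges doubleton_eq_iff)

lemma slc_adjacent_iff:
  "x \<in> nbrs (simple_local_complement G v) w \<longleftrightarrow>
    (x \<in> nbrs G w) \<noteq> (w \<in> nbrs G v \<and> x \<in> nbrs G v \<and> x \<noteq> w)"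
proof -
  have "{w, x} \<in> {{x, y} |x y. x \<in> nbrs G v \<and> y \<in> nbrs G v \<and> x \<noteq> y} \<longleftrightarrow>
      w \<in> nbrs G v \<and> x \<in> nbrs G v \<and> x \<noteq> w"
    by (auto simp: doubleton_eq_iff)
  then have "{w, x} \<in> edges (simple_local_complement G v) \<longleftrightarrow>
      ({w, x} \<in> edges G) \<noteq> (w \<in> nbrs G v \<and> x \<in> nbrs G v \<and> x \<noteq> w)"
    unfolding simple_local_complement_def edges_toggle_edges by simp
  moreover have "x \<in> verts G" if "x \<in> nbrs G v" using that nbrs_subset by fast
  ultimately show ?thesis unfolding nbrs_def[of _ w] by auto
qed

lemma nbrs_slc:
  "nbrs (simple_local_complement G v) w =
    (if w \<in> nbrs G v then sym_diff (nbrs G w) (nbrs G v - {w}) else nbrs G w)"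
  by (auto simp: slc_adjacent_iff)

text \<open>Since \<open>w\<close> is not in \<open>Y\<close>, leaving \<open>w\<close> itself out
  of the toggled neighbours makes no difference inside \<open>Y\<close>.\<close>

lemma odd_card_nbrs_slc:
  assumes G: "looped_graph G" and w: "w \<notin> Y"
  shows "odd (card (nbrs (simple_local_complement G v) w \<inter> Y)) \<longleftrightarrow>
    odd (card (nbrs G w \<inter> Y)) \<noteq> (w \<in> nbrs G v \<and> odd (card (nbrs G v \<inter> Y)))"
proof (cases "w \<in> nbrs G v")
  case True
  have "nbrs (simple_local_complement G v) w \<inter> Y = sym_diff (nbrs G w \<inter> Y) (nbrs G v \<inter> Y)"
    using True w by (auto simp: slc_adjacent_iff)
  then show ?thesis
    using True odd_card_sym_diff[of "nbrs G w \<inter> Y" "nbrs G v \<inter> Y"] finite_nbrs[OF G] by simp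
qed (simp add: nbrs_slc)

text \<open>Off the diagonal, local complementation at \<open>v\<close> changes the entry \<open>A(y, w)\<close> to
  \<open>A(y, w) + A(v, y) A(v, w)\<close>; the new term is compensated by toggling \<open>v\<close> in the set.\<close>

lemma supp_slc:
  assumes G: "looped_graph G" and v: "v \<in> verts G" and Y: "Y \<subseteq> verts G"
  shows "supp (simple_local_complement G v) Y =
    supp G (if odd (card (nbrs G v \<inter> Y)) then sym_diff Y {v} else Y)" (is "supp ?H Y = _")
proof -
  have out: "w \<in> odd_nbrs ?H Y \<longleftrightarrow>
      (w \<in> odd_nbrs G Y) \<noteq> (w \<in> nbrs G v \<and> odd (card (nbrs G v \<inter> Y)))" if "w \<notin> Y" for w
    using odd_card_nbrs_slc[OF G that, of v] nbrs_subset[of G v] by (auto simp: odd_nbrs_def)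
  show ?thesis
  proof (cases "odd (card (nbrs G v \<inter> Y))")
    case False
    then have "w \<in> supp ?H Y \<longleftrightarrow> w \<in> supp G Y" for w
      using out[of w] by (cases "w \<in> Y") (simp_all add: supp_def)
    then show ?thesis using False by auto
  next
    case True
    have o: "odd_nbrs G (sym_diff Y {v}) = sym_diff (odd_nbrs G Y) (nbrs G v)"
      unfolding odd_nbrs_sym_diff[OF G] odd_nbrs_single[OF v] ..
    have "w \<in> supp ?H Y \<longleftrightarrow> w \<in> supp G (sym_diff Y {v})" for w
    proof (cases "w = v")
      \<comment> \<open>Membership of \<open>v\<close> in the set changes, but its odd number of
        neighbours in \<open>Y\<close> keeps it in both supports.\<close>
      case eq: True
      have "v \<in> odd_nbrs ?H Y" "v \<in> odd_nbrs G Y"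
        using True v by (simp_all add: odd_nbrs_def nbrs_slc)
      then show ?thesis unfolding eq supp_def o by simp
    next
      case False
      then show ?thesis
        using out[of w] True unfolding supp_def o by (cases "w \<in> Y") auto
    qed
    then show ?thesis using True by auto
  qed
qed

text \<open>Every support in the new graph is a support in the old one, and it is nonempty because
  it contains \<open>Y\<close>.\<close>

lemma extremal_slc:
  assumes G: "looped_graph G" and ex: "extremal_graph G" and v: "v \<in> verts G"
  shows "extremal_graph (simple_local_complement G v)"
  unfolding extremal_graph_def
proof (intro allI impI)
  let ?H = "simple_local_complement G v"
  fix Y assume "Y \<subseteq> verts ?H" and ne: "Y \<noteq> {}"
  then have Y: "Y \<subseteq> verts G" by simp
  define Z where "Z = (if odd (card (nbrs G v \<inter> Y)) then sym_diff Y {v} else Y)"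
  have eq: "supp ?H Y = supp G Z" unfolding Z_def by (rule supp_slc[OF G v Y])
  have "Z \<subseteq> verts G" using Y v by (auto simp: Z_def)
  moreover have "Z \<noteq> {}"
  proof
    assume "Z = {}"
    then have "supp ?H Y = {}" using eq by (simp add: supp_def)
    then show False using ne by (simp add: supp_def)
  qed
  ultimately show "card (verts ?H) < 2 * card (supp ?H Y)"
    using ex unfolding eq extremal_graph_def by simp
qed

text \<open>Only simple local complementations are used to reach the pentagon or the wheel, because
  they commute with deleting another vertex; loops are dealt with afterwards.\<close>

definition slc_step :: "'a graph \<Rightarrow> 'a graph \<Rightarrow> bool" where
  "slc_step G H \<longleftrightarrow> (\<exists>v\<in>verts G. H = simple_local_complement G v)"

lemma slc_steps_locally_equivalent:
  assumes "slc_step\<^sup>*\<^sup>* G H"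
  shows "locally_equivalent G H"
proof -
  have "local_step\<^sup>*\<^sup>* G H"
    using assms
  proof (rule rtranclp_mono[THEN predicate2D, rotated], intro predicate2I)
    show "local_step G H" if "slc_step G H" for G H :: "'a graph"
      using that unfolding slc_step_def local_step_def by blast
  qed
  then show ?thesis by (simp add: locally_equivalent_def)
qed

lemma slc_steps_extremal:
  assumes "slc_step\<^sup>*\<^sup>* G H" "looped_graph G" "extremal_graph G"
  shows "looped_graph H \<and> extremal_graph H \<and> verts H = verts G"
  using assms(1)
proof (induction rule: rtranclp_induct)
  case base
  show ?case using assms(2,3) by blast
next
  case (step H K)
  then obtain v where "v \<in> verts H" "K = simple_local_complement H v" unfolding slc_step_def by blast
  then show ?case using step.IH by (simp add: looped_slc extremal_slc)
qed

text \<open>Loop complements remove the loops one by one without affecting neighbourhoods. This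
  matters because \<open>graph_iso\<close> also compares loops, which \<open>cycle5\<close> and
  \<open>wheel5\<close> lack.\<close>

lemma remove_loops:
  assumes "looped_graph G"
  shows "\<exists>H. locally_equivalent G H \<and> looped_graph H \<and> verts H = verts G \<and> nbrs H = nbrs G \<and>
    (\<forall>v. {v} \<notin> edges H)"
  using assms
proof (induction "card {v \<in> verts G. {v} \<in> edges G}" arbitrary: G rule: less_induct)
  case less
  show ?case
  proof (cases "\<exists>v. {v} \<in> edges G")
    case False
    then show ?thesis
      using less.prems by (intro exI[of _ G]) (simp add: locally_equivalent_def)
  next
    case True
    then obtain v where v: "{v} \<in> edges G" by blast
    then have vV: "v \<in> verts G"
      using less.prems unfolding looped_graph_def by (metis insertI1 singletonD)
    let ?H = "loop_complement G v"
    have "{w \<in> verts ?H. {w} \<in> edges ?H} = {w \<in> verts G. {w} \<in> edges G} - {v}"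
      using v by (auto simp: loop_complement_def edges_toggle_edges)
    moreover have "card ({w \<in> verts G. {w} \<in> edges G} - {v}) < card {w \<in> verts G. {w} \<in> edges G}"
      using v vV finite_verts[OF less.prems] by (intro card_Diff1_less) auto
    ultimately have "card {w \<in> verts ?H. {w} \<in> edges ?H} < card {w \<in> verts G. {w} \<in> edges G}"
      by simp
    then obtain K where K: "locally_equivalent ?H K" "looped_graph K" "verts K = verts ?H"
      "nbrs K = nbrs ?H" "\<forall>v. {v} \<notin> edges K"
      using less.hyps looped_loop_complement[OF less.prems vV] by blast
    have "local_step G ?H" using vV by (auto simp: local_step_def)
    then have "locally_equivalent G K"
      using K(1) unfolding locally_equivalent_def by (rule converse_rtranclp_into_rtranclp)
    then show ?thesis using K by (auto simp: nbrs_loop_complement)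
  qed
qed

lemma edges_iff_nbrs:
  assumes "\<forall>v. {v} \<notin> edges G" "u \<in> verts G" "v \<in> verts G"
  shows "{u, v} \<in> edges G \<longleftrightarrow> v \<in> nbrs G u"
  using assms by (cases "u = v") (auto simp: nbrs_def)

section \<open>Vertex deletion\<close>

definition delete_vertex :: "'a graph \<Rightarrow> 'a \<Rightarrow> 'a graph" where
  "delete_vertex G v = \<lparr>verts = verts G - {v}, edges = {e \<in> edges G. v \<notin> e}\<rparr>"

lemma verts_delete [simp]: "verts (delete_vertex G v) = verts G - {v}"
  by (simp add: delete_vertex_def)

lemma nbrs_delete: "w \<noteq> v \<Longrightarrow> nbrs (delete_vertex G v) w = nbrs G w - {v}"
  by (auto simp: nbrs_def delete_vertex_def)

lemma looped_delete: "looped_graph G \<Longrightarrow> looped_graph (delete_vertex G v)"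
  unfolding looped_graph_def delete_vertex_def by fastforce

lemma slc_delete:
  assumes "w \<noteq> v"
  shows "simple_local_complement (delete_vertex G v) w = delete_vertex (simple_local_complement G w) v"
proof -
  define F where "F = {{x, y} | x y. x \<in> nbrs G w \<and> y \<in> nbrs G w \<and> x \<noteq> y}"
  define F' where "F' = {{x, y} | x y. x \<in> nbrs G w - {v} \<and> y \<in> nbrs G w - {v} \<and> x \<noteq> y}"
  have F: "F' = {e \<in> F. v \<notin> e}" unfolding F_def F'_def by fast
  have "toggle_edges F' (delete_vertex G v) = delete_vertex (toggle_edges F G) v"
    unfolding F toggle_edges_def delete_vertex_def by (simp; blast)
  then show ?thesis
    unfolding simple_local_complement_def nbrs_delete[OF assms] F_def F'_def .
qed

text \<open>Complementations in \<open>G - v\<close> are never performed at \<open>v\<close>, so by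
  \<open>slc_delete\<close> they lift to \<open>G\<close>.\<close>

lemma slc_steps_delete:
  assumes "slc_step\<^sup>*\<^sup>* (delete_vertex G v) H'"
  shows "\<exists>H. slc_step\<^sup>*\<^sup>* G H \<and> H' = delete_vertex H v"
  using assms
proof (induction rule: rtranclp_induct)
  case base
  then show ?case by blast
next
  case (step H' K')
  then obtain H where H: "slc_step\<^sup>*\<^sup>* G H" "H' = delete_vertex H v" by blast
  obtain w where w: "w \<in> verts H" "w \<noteq> v" "K' = simple_local_complement H' w"
    using step.hyps(2) H(2) by (auto simp: slc_step_def)
  have "slc_step H (simple_local_complement H w)" using w(1) by (auto simp: slc_step_def)
  then show ?case
    using H w(3) slc_delete[OF w(2), of H] by (meson rtranclp.rtrancl_into_rtrancl)
qed

text \<open>Deleting \<open>v\<close> lowers a weight by at most one. For even \<open>n\<close>, a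
  weight above \<open>n / 2\<close> is at least \<open>n / 2 + 1\<close>, and one less still exceeds
  \<open>(n - 1) / 2\<close>.\<close>

lemma extremal_delete:
  assumes G: "looped_graph G" and ex: "extremal_graph G" and ev: "even (card (verts G))"
    and v: "v \<in> verts G"
  shows "extremal_graph (delete_vertex G v)"
  unfolding extremal_graph_def
proof (intro allI impI)
  let ?H = "delete_vertex G v"
  fix Y assume Y: "Y \<subseteq> verts ?H" "Y \<noteq> {}"
  then have YG: "Y \<subseteq> verts G" "v \<notin> Y" by auto
  have "nbrs ?H w \<inter> Y = nbrs G w \<inter> Y" if "w \<noteq> v" for w
    using nbrs_delete[OF that, of G] YG by auto
  then have "supp G Y \<subseteq> insert v (supp ?H Y)" by (auto simp: supp_def odd_nbrs_def)
  then have "card (supp G Y) \<le> card (insert v (supp ?H Y))"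
    using finite_supp[OF looped_delete[OF G] Y(1)] by (intro card_mono) auto
  also have "\<dots> \<le> Suc (card (supp ?H Y))" by (rule card_insert_le_m1[THEN order_trans]) auto
  finally have "card (supp G Y) \<le> Suc (card (supp ?H Y))" .
  moreover have "card (verts G) < 2 * card (supp G Y)"
    using ex YG(1) Y(2) unfolding extremal_graph_def by blast
  moreover have "card (verts ?H) = card (verts G) - 1" using v by simp
  moreover have "card (verts G) > 0" using v finite_verts[OF G] by (auto simp: card_gt_0_iff)
  ultimately show "card (verts ?H) < 2 * card (supp ?H Y)" using ev by presburger
qed

lemma extremal_card:
  assumes G: "looped_graph G" and ex: "extremal_graph G" and n: "card (verts G) \<ge> 5"
  shows "card (verts G) = 5 \<or> card (verts G) = 6"
proof (cases "even (card (verts G))")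
  case False
  then obtain m where m: "card (verts G) = 2 * m + 1" by (rule oddE)
  then have "m < 3" by (rule extremal_odd_card[OF G ex])
  then show ?thesis using m n by linarith
next
  case True
  then obtain m where m: "card (verts G) = 2 * m" by (rule evenE)
  have "verts G \<noteq> {}" using n by auto
  then obtain v where v: "v \<in> verts G" by blast
  have "card (verts (delete_vertex G v)) = 2 * (m - 1) + 1" using v m n by simp
  then have "m - 1 < 3"
    by (rule extremal_odd_card[OF looped_delete[OF G] extremal_delete[OF G ex True v]])
  then show ?thesis using m n by linarith
qed

section \<open>Extremal graphs on five and six vertices\<close>

text \<open>The support of a singleton is its closed neighbourhood. The minimum degree is thus at
  least two on five vertices and three on six.\<close>

lemma extremal_degree:
  assumes G: "looped_graph G" and ex: "extremal_graph G" and v: "v \<in> verts G"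
  shows "card (verts G) < 2 * card (nbrs G v) + 2"
proof -
  have "supp G {v} = insert v (nbrs G v)" using odd_nbrs_single[OF v] by (simp add: supp_def)
  then have "card (supp G {v}) = Suc (card (nbrs G v))" using finite_nbrs[OF G] by simp
  moreover have "card (verts G) < 2 * card (supp G {v})"
    using ex v unfolding extremal_graph_def by blast
  ultimately show ?thesis by simp
qed

text \<open>The neighbourhoods of twins cancel outside the pair, leaving a word of weight
  two.\<close>

lemma extremal_no_twins:
  assumes G: "looped_graph G" and ex: "extremal_graph G" and n: "4 \<le> card (verts G)"
    and uv: "u \<in> verts G" "v \<in> verts G" "u \<noteq> v"
  shows "nbrs G u - {v} \<noteq> nbrs G v - {u}"
proof
  assume eq: "nbrs G u - {v} = nbrs G v - {u}"
  have "{u, v} = sym_diff {u} {v}" using uv(3) by auto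
  then have "odd_nbrs G {u, v} = sym_diff (nbrs G u) (nbrs G v)"
    using odd_nbrs_sym_diff[OF G, of "{u}" "{v}"] odd_nbrs_single uv by metis
  then have "supp G {u, v} = {u, v}" unfolding supp_def using eq by blast
  then have "card (supp G {u, v}) \<le> 2" by (simp add: card_insert_if)
  moreover have "card (verts G) < 2 * card (supp G {u, v})"
    using ex[unfolded extremal_graph_def, rule_format, of "{u, v}"] uv(1,2) by simp
  ultimately show False using n by linarith
qed

definition pentagon :: "'a graph \<Rightarrow> 'a \<Rightarrow> 'a \<Rightarrow> 'a \<Rightarrow> 'a \<Rightarrow> 'a \<Rightarrow> bool" where
  "pentagon G a b c d e \<longleftrightarrow> distinct [a, b, c, d, e] \<and> verts G = {a, b, c, d, e} \<and>
     nbrs G a = {b, e} \<and> nbrs G b = {a, c} \<and> nbrs G c = {b, d} \<and> nbrs G d = {c, e} \<and>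
     nbrs G e = {d, a}"

lemma pentagonI:
  assumes "distinct [a, b, c, d, e]" and V: "verts G = {a, b, c, d, e}"
    and adj: "b \<in> nbrs G a" "c \<notin> nbrs G a" "d \<notin> nbrs G a" "e \<in> nbrs G a"
      "c \<in> nbrs G b" "d \<notin> nbrs G b" "e \<notin> nbrs G b"
      "d \<in> nbrs G c" "e \<notin> nbrs G c" "e \<in> nbrs G d"
  shows "pentagon G a b c d e"
proof -
  have N: "nbrs G x = {y \<in> {a, b, c, d, e}. y \<in> nbrs G x}" for x
    using nbrs_subset[of G x] V by auto
  have sym: "a \<in> nbrs G b \<longleftrightarrow> b \<in> nbrs G a" "a \<in> nbrs G c \<longleftrightarrow> c \<in> nbrs G a"
    "a \<in> nbrs G d \<longleftrightarrow> d \<in> nbrs G a" "a \<in> nbrs G e \<longleftrightarrow> e \<in> nbrs G a"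
    "b \<in> nbrs G c \<longleftrightarrow> c \<in> nbrs G b" "b \<in> nbrs G d \<longleftrightarrow> d \<in> nbrs G b"
    "b \<in> nbrs G e \<longleftrightarrow> e \<in> nbrs G b" "c \<in> nbrs G d \<longleftrightarrow> d \<in> nbrs G c"
    "c \<in> nbrs G e \<longleftrightarrow> e \<in> nbrs G c" "d \<in> nbrs G e \<longleftrightarrow> e \<in> nbrs G d"
    using V by (intro nbrs_sym_iff; simp)+
  have "nbrs G a = {b, e}" by (subst N) (use adj in auto)
  moreover have "nbrs G b = {a, c}" by (subst N) (use adj sym in auto)
  moreover have "nbrs G c = {b, d}" by (subst N) (use adj sym in auto)
  moreover have "nbrs G d = {c, e}" by (subst N) (use adj sym in auto)
  moreover have "nbrs G e = {d, a}" by (subst N) (use adj sym in auto)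
  ultimately show ?thesis using assms(1) V unfolding pentagon_def by blast
qed

text \<open>Five vertices cannot all have degree three. If \<open>a\<close> has degree four,
  complementing at \<open>a\<close> changes the degree of any other \<open>v\<close> to five minus
  its old value; both values being at least two, one of them is two.\<close>

lemma extremal_five_degree_two:
  assumes G: "looped_graph G" and ex: "extremal_graph G" and n: "card (verts G) = 5"
  shows "\<exists>H a. slc_step\<^sup>*\<^sup>* G H \<and> a \<in> verts G \<and> card (nbrs H a) = 2"
proof -
  have deg: "2 \<le> card (nbrs G v)" "card (nbrs G v) \<le> 4" if v: "v \<in> verts G" for v
  proof -
    show "2 \<le> card (nbrs G v)" using extremal_degree[OF G ex v] n by linarith
    have "nbrs G v \<subseteq> verts G - {v}" using nbrs_subset[of G v] by auto
    then have "card (nbrs G v) \<le> card (verts G - {v})"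
      using finite_verts[OF G] by (intro card_mono) auto
    then show "card (nbrs G v) \<le> 4" using v n by simp
  qed
  have "\<exists>a\<in>verts G. card (nbrs G a) \<noteq> 3"
  proof (rule ccontr)
    assume "\<not> ?thesis"
    then have "card (nbrs G a \<inter> verts G) = 3" if "a \<in> verts G" for a
      using that nbrs_subset[of G a] by (simp add: Int_absorb2)
    then have "(\<Sum>a\<in>verts G. card (nbrs G a \<inter> verts G)) = 15" using n by simp
    then show False using even_sum_card_nbrs[OF G subset_refl] by simp
  qed
  then obtain a where a: "a \<in> verts G" "card (nbrs G a) \<noteq> 3" by blast
  show ?thesis
  proof (cases "card (nbrs G a) = 2")
    case True
    then show ?thesis using a by blast
  next
    case False
    then have four: "card (nbrs G a) = 4" using deg[OF a(1)] a(2) by linarith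
    have "nbrs G a \<subseteq> verts G - {a}" using nbrs_subset[of G a] by auto
    moreover have "card (verts G - {a}) = 4" using n a by simp
    ultimately have Na: "nbrs G a = verts G - {a}"
      using four finite_verts[OF G] by (intro card_subset_eq) auto
    have "nbrs G a \<noteq> {}" using four by auto
    then obtain v where v: "v \<in> nbrs G a" by blast
    then have vV: "v \<in> verts G" "v \<noteq> a" using Na by auto
    let ?H = "simple_local_complement G a"
    have av: "a \<in> nbrs G v" using nbrs_sym[OF a(1) v] .
    have "nbrs ?H v = insert a (verts G - {v} - nbrs G v)"
      unfolding nbrs_slc using v av Na a(1) nbrs_subset[of G v] by auto
    moreover have "card (verts G - {v} - nbrs G v) = 4 - card (nbrs G v)"
      using vV n finite_nbrs[OF G] nbrs_subset[of G v] by (subst card_Diff_subset) auto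
    ultimately have card: "card (nbrs ?H v) = 5 - card (nbrs G v)"
      using av deg(2)[OF vV(1)] finite_verts[OF G] by simp
    have step: "slc_step\<^sup>*\<^sup>* G ?H" using a(1) unfolding slc_step_def by blast
    have "5 < 2 * card (nbrs ?H v) + 2"
      using extremal_degree[OF looped_slc[OF G] extremal_slc[OF G ex a(1)], of v] vV(1) n by simp
    then consider "card (nbrs G v) = 2" | "card (nbrs ?H v) = 2"
      using card deg(1)[OF vV(1)] by linarith
    then show ?thesis using step vV(1) by cases blast+
  qed
qed

text \<open>The open adjacencies are those between \<open>b\<close>, \<open>c\<close> and
  \<open>d\<close>, \<open>e\<close>. Either they form a matching, which closes a pentagon, or
  exactly one of the four is missing; then complementing at the end of the missing edge in
  \<open>d\<close>, \<open>e\<close> removes the chord.\<close>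

lemma extremal_five_pentagon_at:
  assumes G: "looped_graph G" and ex: "extremal_graph G"
    and dist: "distinct [a, b, c, d, e]" and V: "verts G = {a, b, c, d, e}"
    and Na: "nbrs G a = {b, c}" and bc: "c \<notin> nbrs G b"
  shows "\<exists>H x1 x2 x3 x4 x5. slc_step\<^sup>*\<^sup>* G H \<and> pentagon H x1 x2 x3 x4 x5"
proof -
  have n: "card (verts G) = 5" unfolding V using dist by simp
  have sub: "nbrs G v \<subseteq> {a, b, c, d, e}" for v using nbrs_subset[of G v] V by simp
  have deg: "\<exists>y\<in>{a, b, c, d, e}. y \<in> nbrs G v \<and> y \<noteq> x" if "v \<in> {a, b, c, d, e}" for v x
  proof (rule ccontr)
    assume "\<not> ?thesis"
    then have "nbrs G v \<subseteq> {x}" using sub[of v] by blast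
    then have "card (nbrs G v) \<le> card {x}" by (intro card_mono) simp_all
    then show False using extremal_degree[OF G ex, of v] that n V by simp
  qed
  have sym: "x \<in> nbrs G y \<longleftrightarrow> y \<in> nbrs G x" if "x \<in> {a, b, c, d, e}" "y \<in> {a, b, c, d, e}" for x y
    using nbrs_sym_iff that V by metis
  note s = sym[of b a] sym[of c a] sym[of d a] sym[of e a] sym[of c b] sym[of d b] sym[of e b]
    sym[of d c] sym[of e c] sym[of e d]
  have da: "a \<notin> nbrs G d" "a \<notin> nbrs G e" using sym[of a d] sym[of a e] Na dist by auto
  have cb: "b \<notin> nbrs G c" using sym[of b c] bc by auto
  have 1: "d \<in> nbrs G b \<or> e \<in> nbrs G b" using deg[of b a] bc by auto
  have 2: "d \<in> nbrs G c \<or> e \<in> nbrs G c" using deg[of c a] cb by auto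
  have 3: "(d \<in> nbrs G b) \<noteq> (d \<in> nbrs G c) \<or> (e \<in> nbrs G b) \<noteq> (e \<in> nbrs G c)"
  proof (rule ccontr)
    assume *: "\<not> ?thesis"
    have "a \<in> nbrs G b" "a \<in> nbrs G c" using sym[of a b] sym[of a c] Na by simp_all
    then have "x \<in> nbrs G b \<longleftrightarrow> x \<in> nbrs G c" if "x \<in> {a, b, c, d, e}" for x
      using that * bc cb by (elim insertE emptyE) simp_all
    then have "nbrs G b = nbrs G c" using sub[of b] sub[of c] by blast
    then have "nbrs G b - {c} = nbrs G c - {b}" using bc cb by simp
    moreover have "nbrs G b - {c} \<noteq> nbrs G c - {b}"
      by (rule extremal_no_twins[OF G ex]) (use n V dist in auto)
    ultimately show False by blast
  qed
  \<comment> \<open>Otherwise degree two forces both \<open>d\<close> and \<open>e\<close> to be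
    adjacent to both \<open>b\<close> and \<open>c\<close>, making \<open>b\<close> and
    \<open>c\<close> twins.\<close>
  have 4: "e \<in> nbrs G d"
  proof (rule ccontr)
    assume *: "e \<notin> nbrs G d"
    then have e': "d \<notin> nbrs G e" using s by auto
    have "b \<in> nbrs G d" "c \<in> nbrs G d" using deg[of d b] deg[of d c] * da by auto
    moreover have "b \<in> nbrs G e" "c \<in> nbrs G e" using deg[of e b] deg[of e c] e' da by auto
    ultimately show False using 3 s by auto
  qed
  have slc: "slc_step\<^sup>*\<^sup>* G (simple_local_complement G v)" if "v \<in> verts G" for v
    using that unfolding slc_step_def by blast
  have V2: "verts G = {a, b, d, e, c}" "verts G = {a, b, e, d, c}" using V by auto
  have d2: "distinct [a, b, d, e, c]" "distinct [a, b, e, d, c]" using dist by auto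
  have d3: "distinct [e, d, c, b, a]" using dist by auto
  have Na': "b \<in> nbrs G a" "c \<in> nbrs G a" "d \<notin> nbrs G a" "e \<notin> nbrs G a" using Na dist by auto
  \<comment> \<open>The last four cases are named after the missing edge; \<open>id\<close> and
    \<open>sw\<close> are the two matchings.\<close>
  consider
      (id) "d \<in> nbrs G b" "e \<notin> nbrs G b" "d \<notin> nbrs G c" "e \<in> nbrs G c"
    | (sw) "d \<notin> nbrs G b" "e \<in> nbrs G b" "d \<in> nbrs G c" "e \<notin> nbrs G c"
    | (ce) "d \<in> nbrs G b" "e \<in> nbrs G b" "d \<in> nbrs G c" "e \<notin> nbrs G c"
    | (cd) "d \<in> nbrs G b" "e \<in> nbrs G b" "d \<notin> nbrs G c" "e \<in> nbrs G c"
    | (be) "d \<in> nbrs G b" "e \<notin> nbrs G b" "d \<in> nbrs G c" "e \<in> nbrs G c"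
    | (bd) "d \<notin> nbrs G b" "e \<in> nbrs G b" "d \<in> nbrs G c" "e \<in> nbrs G c"
    using 1 2 3 by blast
  then show ?thesis
  proof cases
    case id
    have "pentagon G a b d e c"
      by (rule pentagonI[OF d2(1) V2(1)]) (use id 4 Na' bc s dist in auto)
    then show ?thesis by blast
  next
    case sw
    have "pentagon G a b e d c"
      by (rule pentagonI[OF d2(2) V2(2)]) (use sw 4 Na' bc s dist in auto)
    then show ?thesis by blast
  next
    case ce
    have "pentagon (simple_local_complement G e) a b e d c"
      by (rule pentagonI[OF d2(2)]) (use ce 4 Na' bc s dist d3 V2(2) in \<open>simp_all add: slc_adjacent_iff\<close>)
    then show ?thesis using slc[of e] V by blast
  next
    case cd
    have "pentagon (simple_local_complement G d) a b d e c"
      by (rule pentagonI[OF d2(1)]) (use cd 4 Na' bc s dist d3 V2(1) in \<open>simp_all add: slc_adjacent_iff\<close>)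
    then show ?thesis using slc[of d] V by blast
  next
    case be
    have "pentagon (simple_local_complement G e) a b d e c"
      by (rule pentagonI[OF d2(1)]) (use be 4 Na' bc s dist d3 V2(1) in \<open>simp_all add: slc_adjacent_iff\<close>)
    then show ?thesis using slc[of e] V by blast
  next
    case bd
    have "pentagon (simple_local_complement G d) a b e d c"
      by (rule pentagonI[OF d2(2)]) (use bd 4 Na' bc s dist d3 V2(2) in \<open>simp_all add: slc_adjacent_iff\<close>)
    then show ?thesis using slc[of d] V by blast
  qed
qed

lemma extremal_five_pentagon:
  assumes G: "looped_graph G" and ex: "extremal_graph G" and n: "card (verts G) = 5"
  shows "\<exists>H a b c d e. slc_step\<^sup>*\<^sup>* G H \<and> pentagon H a b c d e"
proof -
  obtain H a where H: "slc_step\<^sup>*\<^sup>* G H" "a \<in> verts G" "card (nbrs H a) = 2"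
    using extremal_five_degree_two[OF assms] by blast
  have HH: "looped_graph H" "extremal_graph H" "verts H = verts G"
    using slc_steps_extremal[OF H(1) G ex] by auto
  obtain b c where bc: "nbrs H a = {b, c}" "b \<noteq> c" using H(3) by (auto simp: card_2_iff)
  obtain K where K: "slc_step\<^sup>*\<^sup>* G K" "nbrs K a = {b, c}" "c \<notin> nbrs K b"
  proof (cases "c \<in> nbrs H b")
    case False
    then show ?thesis using that H(1) bc(1) by blast
  next
    case True
    \<comment> \<open>Complementing at \<open>a\<close> removes the edge between its two neighbours
      and keeps the neighbourhood of \<open>a\<close>.\<close>
    let ?K = "simple_local_complement H a"
    have "slc_step H ?K" using H(2) HH(3) unfolding slc_step_def by blast
    then have "slc_step\<^sup>*\<^sup>* G ?K" using H(1) by (meson rtranclp.rtrancl_into_rtrancl)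
    moreover have "nbrs ?K a = nbrs H a" by (simp add: nbrs_slc)
    then have "nbrs ?K a = {b, c}" using bc(1) by simp
    moreover have "c \<notin> nbrs ?K b" using True bc by (simp add: slc_adjacent_iff)
    ultimately show ?thesis using that by blast
  qed
  have KK: "looped_graph K" "extremal_graph K" "verts K = verts G"
    using slc_steps_extremal[OF K(1) G ex] by auto
  have abc: "a \<noteq> b" "a \<noteq> c" "b \<in> verts G" "c \<in> verts G"
    using K(2) nbrs_irrefl[of a K] nbrs_subset[of K a] KK(3) by auto
  have "card (verts G - {a, b, c}) = 2"
    using n abc bc(2) H(2) by (subst card_Diff_subset) auto
  then obtain d e where de: "verts G - {a, b, c} = {d, e}" "d \<noteq> e" by (auto simp: card_2_iff)
  have V: "verts K = {a, b, c, d, e}" using de(1) abc H(2) KK(3) by auto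
  have dist: "distinct [a, b, c, d, e]" using de abc bc(2) by auto
  obtain L x1 x2 x3 x4 x5 where L: "slc_step\<^sup>*\<^sup>* K L" "pentagon L x1 x2 x3 x4 x5"
    using extremal_five_pentagon_at[OF KK(1,2) dist V K(2,3)] by blast
  have "slc_step\<^sup>*\<^sup>* G L" using K(1) L(1) by (rule rtranclp_trans)
  then show ?thesis using L(2) by blast
qed

text \<open>Steps turning \<open>G - v\<close> into a pentagon lift to \<open>G\<close>. A rim
  vertex has degree two in the pentagon but at least three in the extremal graph, so it is adjacent
  to \<open>v\<close>.\<close>

lemma extremal_six_wheel:
  assumes G: "looped_graph G" and ex: "extremal_graph G" and n: "card (verts G) = 6"
  shows "\<exists>H v a b c d e. slc_step\<^sup>*\<^sup>* G H \<and> v \<in> verts H \<and> pentagon (delete_vertex H v) a b c d e \<and>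
    nbrs H v = {a, b, c, d, e}"
proof -
  have "verts G \<noteq> {}" using n by auto
  then obtain v where v: "v \<in> verts G" by blast
  have "card (verts (delete_vertex G v)) = 5" using v n by simp
  moreover have "extremal_graph (delete_vertex G v)" using extremal_delete[OF G ex _ v] n by simp
  ultimately obtain H' a b c d e where H': "slc_step\<^sup>*\<^sup>* (delete_vertex G v) H'" "pentagon H' a b c d e"
    using extremal_five_pentagon[OF looped_delete[OF G]] by blast
  obtain H where H: "slc_step\<^sup>*\<^sup>* G H" "H' = delete_vertex H v" using slc_steps_delete[OF H'(1)] by blast
  have HH: "looped_graph H" "extremal_graph H" "verts H = verts G"
    using slc_steps_extremal[OF H(1) G ex] by auto
  have VH: "verts H - {v} = {a, b, c, d, e}" using H'(2) H(2) by (simp add: pentagon_def)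
  have "x \<in> nbrs H v" if x: "x \<in> {a, b, c, d, e}" for x
  proof (rule ccontr)
    assume "x \<notin> nbrs H v"
    have xv: "x \<noteq> v" "x \<in> verts H" using x VH by auto
    then have "v \<notin> nbrs H x" using \<open>x \<notin> nbrs H v\<close> nbrs_sym by metis
    then have "nbrs H' x = nbrs H x" using nbrs_delete[OF xv(1), of H] H(2) by auto
    moreover have "card (nbrs H' x) = 2" using H'(2) x by (auto simp: pentagon_def)
    ultimately show False using extremal_degree[OF HH(1,2) xv(2)] HH(3) n by simp
  qed
  moreover have "nbrs H v \<subseteq> verts H - {v}" using nbrs_subset[of H v] by auto
  ultimately have "nbrs H v = {a, b, c, d, e}" using VH by blast
  then show ?thesis using H H'(2) v HH(3) by blast
qed

section \<open>Isomorphisms onto the cycle and the wheel\<close>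

lemma edges_cycle5: "edges cycle5 = {{0, 1}, {1, 2}, {2, 3}, {3, 4}, {4, 0}}"
proof -
  have 5: "{i. i < (5::nat)} = {0, 1, 2, 3, 4}" by auto
  have "edges cycle5 = (\<lambda>i. {i, (i + 1) mod 5}) ` {i. i < 5}"
    unfolding cycle5_def graph.simps by blast
  then show ?thesis unfolding 5 by (simp add: numeral_2_eq_2)
qed

lemma edges_wheel5:
  "edges wheel5 = {{0, 1}, {1, 2}, {2, 3}, {3, 4}, {4, 0}, {0, 5}, {1, 5}, {2, 5}, {3, 5}, {4, 5}}"
proof -
  have 5: "{i. i < (5::nat)} = {0, 1, 2, 3, 4}" by auto
  have "{{i, 5} | i. i < (5::nat)} = (\<lambda>i. {i, 5}) ` {0, 1, 2, 3, 4}"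
    unfolding 5[symmetric] by blast
  moreover have "edges wheel5 = edges cycle5 \<union> {{i, 5} | i. i < (5::nat)}"
    by (simp add: wheel5_def cycle5_def)
  ultimately show ?thesis unfolding edges_cycle5 by (simp add: insert_commute)
qed

lemma pentagon_iso:
  assumes P: "pentagon G a b c d e" and nl: "\<forall>v. {v} \<notin> edges G"
  shows "graph_iso G cycle5"
proof -
  define f where "f x = (if x = a then 0 else if x = b then 1 else if x = c then 2
    else if x = d then 3 else (4::nat))" for x
  have dist: "distinct [a, b, c, d, e]" and V: "verts G = {a, b, c, d, e}"
    and N: "nbrs G a = {b, e}" "nbrs G b = {a, c}" "nbrs G c = {b, d}" "nbrs G d = {c, e}"
      "nbrs G e = {d, a}" using P by (simp_all add: pentagon_def)
  have f: "f a = 0" "f b = 1" "f c = 2" "f d = 3" "f e = 4" using dist by (auto simp: f_def)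
  have "verts cycle5 = {0, 1, 2, 3, 4}" by (auto simp: cycle5_def)
  then have "bij_betw f (verts G) (verts cycle5)"
    unfolding bij_betw_def V using f by (auto simp: inj_on_def)
  moreover have "\<forall>u\<in>verts G. \<forall>v\<in>verts G. v \<in> nbrs G u \<longleftrightarrow> {f u, f v} \<in> edges cycle5"
    unfolding V edges_cycle5 using dist by (simp add: N f doubleton_eq_iff) blast
  then have "{u, v} \<in> edges G \<longleftrightarrow> {f u, f v} \<in> edges cycle5" if "u \<in> verts G" "v \<in> verts G" for u v
    using edges_iff_nbrs[OF nl that] that by blast
  ultimately show ?thesis unfolding graph_iso_def by blast
qed

lemma wheel_iso:
  assumes P: "pentagon (delete_vertex G w) a b c d e" and w: "w \<in> verts G"
    and Nw: "nbrs G w = {a, b, c, d, e}" and nl: "\<forall>v. {v} \<notin> edges G"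
  shows "graph_iso G wheel5"
proof -
  define f where "f x = (if x = a then 0 else if x = b then 1 else if x = c then 2
    else if x = d then 3 else if x = e then 4 else (5::nat))" for x
  have VD: "verts G - {w} = {a, b, c, d, e}" using P by (simp add: pentagon_def)
  have dist: "distinct [w, a, b, c, d, e]" using P VD by (auto simp: pentagon_def)
  have V: "verts G = {w, a, b, c, d, e}" using VD w by auto
  have D: "nbrs G x = insert w (nbrs (delete_vertex G w) x)" if "x \<in> {a, b, c, d, e}" for x
  proof -
    have "x \<noteq> w" using that dist by auto
    moreover have "w \<in> nbrs G x" using nbrs_sym[OF w, of x] Nw that by simp
    ultimately show ?thesis using nbrs_delete[of x w G] by auto
  qed
  have N: "nbrs G a = {w, b, e}" "nbrs G b = {w, a, c}" "nbrs G c = {w, b, d}"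
    "nbrs G d = {w, c, e}" "nbrs G e = {w, d, a}"
    using D P by (simp_all add: pentagon_def)
  have f: "f a = 0" "f b = 1" "f c = 2" "f d = 3" "f e = 4" "f w = 5" using dist by (auto simp: f_def)
  have "verts wheel5 = {5, 0, 1, 2, 3, 4}" by (auto simp: wheel5_def)
  then have "bij_betw f (verts G) (verts wheel5)"
    unfolding bij_betw_def V using f by (auto simp: inj_on_def)
  moreover have "\<forall>u\<in>verts G. \<forall>v\<in>verts G. v \<in> nbrs G u \<longleftrightarrow> {f u, f v} \<in> edges wheel5"
    unfolding V edges_wheel5 using dist by (simp add: N Nw f doubleton_eq_iff) blast
  then have "{u, v} \<in> edges G \<longleftrightarrow> {f u, f v} \<in> edges wheel5" if "u \<in> verts G" "v \<in> verts G" for u v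
    using edges_iff_nbrs[OF nl that] that by blast
  ultimately show ?thesis unfolding graph_iso_def by blast
qed

lemma pentagon_delete_cong:
  assumes "verts H = verts G" "nbrs H = nbrs G"
  shows "pentagon (delete_vertex H v) a b c d e \<longleftrightarrow> pentagon (delete_vertex G v) a b c d e"
proof -
  \<comment> \<open>\<open>nbrs_delete\<close> covers only vertices other than the deleted
    one.\<close>
  have "nbrs (delete_vertex K v) v = {}" for K :: "'a graph"
    by (auto simp: nbrs_def delete_vertex_def)
  then have "nbrs (delete_vertex H v) x = nbrs (delete_vertex G v) x" for x
    using assms(2) nbrs_delete[of x v] by (cases "x = v") simp_all
  then show ?thesis using assms(1) by (simp add: pentagon_def)
qed

lemma extremal_locally_equivalent:
  assumes G: "looped_graph G" and ex: "extremal_graph G" and n: "card (verts G) \<ge> 5"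
  shows "\<exists>H. locally_equivalent G H \<and> (graph_iso H cycle5 \<or> graph_iso H wheel5)"
proof -
  have trans: "locally_equivalent G K" if "slc_step\<^sup>*\<^sup>* G H" "locally_equivalent H K" for H K
    using slc_steps_locally_equivalent[OF that(1)] that(2) unfolding locally_equivalent_def
    by (rule rtranclp_trans)
  from extremal_card[OF assms] show ?thesis
  proof
    assume "card (verts G) = 5"
    then obtain H a b c d e where H: "slc_step\<^sup>*\<^sup>* G H" "pentagon H a b c d e"
      using extremal_five_pentagon[OF G ex] by blast
    have "looped_graph H" using slc_steps_extremal[OF H(1) G ex] by blast
    then obtain K where K: "locally_equivalent H K" "verts K = verts H" "nbrs K = nbrs H"
      "\<forall>v. {v} \<notin> edges K" using remove_loops by blast
    have "pentagon K a b c d e" using H(2) K(2,3) by (simp add: pentagon_def)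
    then have "graph_iso K cycle5" using K(4) by (rule pentagon_iso)
    then show ?thesis using trans[OF H(1) K(1)] by blast
  next
    assume "card (verts G) = 6"
    then obtain H w a b c d e where H: "slc_step\<^sup>*\<^sup>* G H" "w \<in> verts H"
      "pentagon (delete_vertex H w) a b c d e" "nbrs H w = {a, b, c, d, e}"
      using extremal_six_wheel[OF G ex] by blast
    have "looped_graph H" using slc_steps_extremal[OF H(1) G ex] by blast
    then obtain K where K: "locally_equivalent H K" "verts K = verts H" "nbrs K = nbrs H"
      "\<forall>v. {v} \<notin> edges K" using remove_loops by blast
    have "pentagon (delete_vertex K w) a b c d e" using H(3) pentagon_delete_cong[OF K(2,3)] by simp
    then have "graph_iso K wheel5" using H(2,4) K(2-4) by (intro wheel_iso) auto
    then show ?thesis using trans[OF H(1) K(1)] by blast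
  qed
qed

text \<open>On four vertices the odd alternative of \<open>vertical_connectivity_prime\<close> would
  need six vertices, so \<kappa> would be four and the graph extremal.\<close>

lemma prime_card_ne_4:
  assumes G: "looped_graph G" and p: "prime_graph G"
  shows "card (verts G) \<noteq> 4"
proof
  assume n: "card (verts G) = 4"
  then have "vertical_connectivity (isotropic_matroid G) = card (verts G)"
    using vertical_connectivity_prime[OF G _ p] by simp
  then show False
    using extremal_if_vertical_connectivity[OF G] extremal_card_ne_4[OF G] n by blast
qed

theorem theorem3:
  fixes G :: "'a graph"
  assumes "looped_graph G"
  shows "let n = card (verts G);
             \<kappa> = vertical_connectivity (isotropic_matroid G);
             C1 = (n \<le> 3 \<and> connected_graph G);
             C2 = (\<not> connected_graph G);
             C3 = (n \<ge> 4 \<and> connected_graph G \<and> \<not> prime_graph G);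
             C4 = (n \<ge> 5 \<and> prime_graph G \<and> \<kappa> < n);
             C5 = (n \<ge> 5 \<and> \<kappa> = n)
         in (\<exists>!i. i < 5 \<and> [C1, C2, C3, C4, C5] ! i) \<and>
            (C1 \<longrightarrow> \<kappa> = n) \<and>
            (C2 \<longrightarrow> \<kappa> = 1) \<and>
            (C3 \<longrightarrow> \<kappa> = 3) \<and>
            (C4 \<longrightarrow> odd \<kappa> \<and> \<kappa> \<ge> 5) \<and>
            (C5 \<longrightarrow> (\<exists>H. locally_equivalent G H \<and> (graph_iso H cycle5 \<or> graph_iso H wheel5)))"
proof -
  define n where "n = card (verts G)"
  define \<kappa> where "\<kappa> = vertical_connectivity (isotropic_matroid G)"
  define C1 where "C1 = (n \<le> 3 \<and> connected_graph G)"
  define C2 where "C2 = (\<not> connected_graph G)"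
  define C3 where "C3 = (n \<ge> 4 \<and> connected_graph G \<and> \<not> prime_graph G)"
  define C4 where "C4 = (n \<ge> 5 \<and> prime_graph G \<and> \<kappa> < n)"
  define C5 where "C5 = (n \<ge> 5 \<and> \<kappa> = n)"
  note G = assms
  have le: "\<kappa> \<le> n" unfolding \<kappa>_def n_def by (rule vertical_connectivity_le_card[OF G])
  have 1: "C1 \<longrightarrow> \<kappa> = n"
    unfolding C1_def \<kappa>_def n_def using vertical_connectivity_small[OF G] by blast
  have 2: "C2 \<longrightarrow> \<kappa> = 1"
    unfolding C2_def \<kappa>_def using vertical_connectivity_disconnected[OF G] by blast
  have 3: "C3 \<longrightarrow> \<kappa> = 3"
    unfolding C3_def \<kappa>_def n_def using vertical_connectivity_split[OF G] by blast
  have 4: "C4 \<longrightarrow> odd \<kappa> \<and> \<kappa> \<ge> 5"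
    unfolding C4_def \<kappa>_def n_def using vertical_connectivity_prime[OF G] by auto
  have 5: "C5 \<longrightarrow> (\<exists>H. locally_equivalent G H \<and> (graph_iso H cycle5 \<or> graph_iso H wheel5))"
    unfolding C5_def \<kappa>_def n_def
    using extremal_locally_equivalent[OF G extremal_if_vertical_connectivity[OF G]] by blast
  \<comment> \<open>This closes the gap between the third case, which starts at four vertices, and
    the last two, which start at five.\<close>
  have p: "connected_graph G" "n \<noteq> 4" if "prime_graph G" "n \<ge> 4"
    using that disconnected_not_prime[OF G] prime_card_ne_4[OF G] unfolding n_def by auto
  have ex: "C1 \<or> C2 \<or> C3 \<or> C4 \<or> C5"
  proof (cases "n \<ge> 5")
    case True
    then show ?thesis using le p unfolding C2_def C3_def C4_def C5_def by auto
  next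
    case False
    then show ?thesis using p unfolding C1_def C2_def C3_def by (cases "n \<le> 3") auto
  qed
  \<comment> \<open>The fifth case excludes the second and third because \<kappa> is 1 or 3 there;
    the fourth excludes the second because its graphs are connected.\<close>
  have unique: "\<not> (C1 \<and> C2)" "\<not> (C1 \<and> C3)" "\<not> (C1 \<and> C4)" "\<not> (C1 \<and> C5)" "\<not> (C2 \<and> C3)"
    "\<not> (C2 \<and> C4)" "\<not> (C2 \<and> C5)" "\<not> (C3 \<and> C4)" "\<not> (C3 \<and> C5)" "\<not> (C4 \<and> C5)"
    using 2 3 p unfolding C1_def C2_def C3_def C4_def C5_def by auto
  \<comment> \<open>List positions start at 0, so case number k sits at position k - 1.\<close>
  have nth: "i < 5 \<and> [C1, C2, C3, C4, C5] ! i \<longleftrightarrow>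
      i = 0 \<and> C1 \<or> i = 1 \<and> C2 \<or> i = 2 \<and> C3 \<or> i = 3 \<and> C4 \<or> i = 4 \<and> C5" for i
  proof (cases "i < 5")
    case True
    then have "i \<in> {0, 1, 2, 3, 4}" by auto
    then show ?thesis by (elim insertE emptyE) (simp_all add: numeral_2_eq_2 numeral_3_eq_3)
  qed auto
  have "\<exists>!i. i < 5 \<and> [C1, C2, C3, C4, C5] ! i"
    using ex
  proof (elim disjE)
    show ?thesis if C1 unfolding nth by (rule ex1I[of _ 0]) (use that unique in blast)+
    show ?thesis if C2 unfolding nth by (rule ex1I[of _ 1]) (use that unique in blast)+
    show ?thesis if C3 unfolding nth by (rule ex1I[of _ 2]) (use that unique in blast)+
    show ?thesis if C4 unfolding nth by (rule ex1I[of _ 3]) (use that unique in blast)+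
    show ?thesis if C5 unfolding nth by (rule ex1I[of _ 4]) (use that unique in blast)+
  qed
  then have "(\<exists>!i. i < 5 \<and> [C1, C2, C3, C4, C5] ! i) \<and>
      (C1 \<longrightarrow> \<kappa> = n) \<and> (C2 \<longrightarrow> \<kappa> = 1) \<and> (C3 \<longrightarrow> \<kappa> = 3) \<and> (C4 \<longrightarrow> odd \<kappa> \<and> \<kappa> \<ge> 5) \<and>
      (C5 \<longrightarrow> (\<exists>H. locally_equivalent G H \<and> (graph_iso H cycle5 \<or> graph_iso H wheel5)))"
    using 1 2 3 4 5 by (intro conjI)
  then show ?thesis
    unfolding C1_def C2_def C3_def C4_def C5_def n_def \<kappa>_def Let_def .
qed

end
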